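(* Let $f:\mathbb{R}^d\to\mathbb{R}$, let ${\bm{x}}^\star$ be a local minimizer of $f$ with $f$ twice differentiable in a neighborhood of ${\bm{x}}^\star$, and let ${\bm{H}}:=\nabla^2 f({\bm{x}}^\star)$ satisfy ${\bm{H}}\succeq0$, ${\bm{H}}\neq{\bm{0}}$. Let ${\bm{P}}\succ0$ be a fixed symmetric positive definite matrix and let $\tilde\lambda_1\ge\cdots\ge\tilde\lambda_d\ge0$ be the eigenvalues of ${\bm{P}}^{-1}{\bm{H}}$, with $\lambda_{\max}({\bm{P}}^{-1}{\bm{H}}):=\tilde\lambda_1$. Consider Frozen ZO-Adam with step size $\eta>0$, $\beta_1\in[0,1)$ and smoothing parameter $\mu>0$ applied to $f_{\mathrm{quad}}({\bm{x}})=f({\bm{x}}^\star)+\tfrac12({\bm{x}}-{\bm{x}}^\star)^\top{\bm{H}}({\bm{x}}-{\bm{x}}^\star)$: \[ {\bm{m}}_{t+1}=\beta_1{\bm{m}}_t+(1-\beta_1)\widehat\nabla f_{\mathrm{quad}}({\bm{x}}_t),\qquad {\bm{x}}_{t+1}={\bm{x}}_t-\eta{\bm{P}}^{-1}{\bm{m}}_{t+1},\qquad{\bm{m}}_0={\bm{0}}, \] where $\widehat\nabla f_{\mathrm{quad}}({\bm{x}}_t)=\frac{f_{\mathrm{quad}}({\bm{x}}_t+\mu{\bm{u}}_t)-f_{\mathrm{quad}}({\bm{x}}_t-\mu{\bm{u}}_t)}{2\mu}{\bm{u}}_t$ with ${\bm{u}}_t\overset{\mathrm{i.i.d.}}{\sim}\mathcal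 N({\bm{0}},{\bm{I}}_d)$. Then $\eta^\star_{\mathrm{mean}}=2(1+\beta_1)/\bigl((1-\beta_1)\lambda_{\max}({\bm{P}}^{-1}{\bm{H}})\bigr)$. Moreover, if ${\bm{P}}{\bm{H}}={\bm{H}}{\bm{P}}$, the mean-square critical step size $\eta^\star_{\mathrm{ms}}$ is the unique $\eta>0$ satisfying \[ \eta\lambda_{\max}({\bm{P}}^{-1}{\bm{H}})<1+\beta_1\quad\text{and}\quad\sum_{i=1}^d\frac{\eta\tilde\lambda_i}{2\bigl(1-\frac{\eta\tilde\lambda_i}{1+\beta_1}\bigr)}=1, \] and it satisfies \[ \frac{2}{\Tr({\bm{P}}^{-1}{\bm{H}})+\frac{2\lambda_{\max}({\bm{P}}^{-1}{\bm{H}})}{1+\beta_1}}\le\eta^\star_{\mathrm{ms}}\le\frac{2}{\Tr({\bm{P}}^{-1}{\bm{H}})}. \]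
   Context: For an optimizer with step size $\eta$ applied to $f_{\mathrm{quad}}$ producing iterates $\{{\bm{x}}_t\}_{t\ge0}$ (with the auxiliary momentum initialized at ${\bm{0}}$), the critical step size in the mean is $\eta^\star_{\mathrm{mean}}:=\sup\{\eta>0:\ \forall {\bm{x}}_0\in\mathbb{R}^d,\ \sup_{t\ge0}\|\mathbb{E}[{\bm{x}}_t-{\bm{x}}^\star]\|<\infty\}$ and the mean-square critical step size is $\eta^\star_{\mathrm{ms}}:=\sup\{\eta>0:\ \forall {\bm{x}}_0\in\mathbb{R}^d,\ \sup_{t\ge0}\mathbb{E}\|{\bm{x}}_t-{\bm{x}}^\star\|^2<\infty\}$. The eigenvalues of ${\bm{P}}^{-1}{\bm{H}}$ are real and nonnegative since it is similar to ${\bm{P}}^{-1/2}{\bm{H}}{\bm{P}}^{-1/2}\succeq0$. *)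

theory Defs
  imports "HOL-Probability.Probability" "HOL-Computational_Algebra.Polynomial"
begin

definition charpoly :: "real^'n^'n \<Rightarrow> real poly" where
  "charpoly A = det (\<chi> i j. (if i = j then [:0, 1:] else 0) - [:A $ i $ j:])"

definition f_quad :: "real \<Rightarrow> real^'n^'n \<Rightarrow> real^'n \<Rightarrow> real^'n \<Rightarrow> real" where
  "f_quad fstar H xstar x = fstar + (1/2) * ((x - xstar) \<bullet> (H *v (x - xstar)))"

definition zo_grad :: "(real^'n \<Rightarrow> real) \<Rightarrow> real \<Rightarrow> real^'n \<Rightarrow> real^'n \<Rightarrow> real^'n" where
  "zo_grad g mu x u = ((g (x + mu *\<^sub>R u) - g (x - mu *\<^sub>R u)) / (2 * mu)) *\<^sub>R u"

text \<open>Sample space: omega (t, j) is the j-th coordinate of the t-th Gaussian direction u_t;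
  all coordinates are i.i.d. N(0,1), so the u_t are i.i.d. N(0, I_d).\<close>
definition gauss_space :: "((nat \<times> 'n::finite) \<Rightarrow> real) measure" where
  "gauss_space = (\<Pi>\<^sub>M i\<in>UNIV. density lborel std_normal_density)"

definition gdir :: "((nat \<times> 'n::finite) \<Rightarrow> real) \<Rightarrow> nat \<Rightarrow> real^'n" where
  "gdir \<omega> t = (\<chi> j. \<omega> (t, j))"

fun zo_adam :: "(real^'n \<Rightarrow> real) \<Rightarrow> real^'n^'n \<Rightarrow> real \<Rightarrow> real \<Rightarrow> real \<Rightarrow> real^'n
     \<Rightarrow> ((nat \<times> 'n::finite) \<Rightarrow> real) \<Rightarrow> nat \<Rightarrow> (real^'n) \<times> (real^'n)" where
  "zo_adam g P mu beta1 eta x0 \<omega> 0 = (x0, 0)"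
| "zo_adam g P mu beta1 eta x0 \<omega> (Suc t) =
     (let (x, m) = zo_adam g P mu beta1 eta x0 \<omega> t;
          m' = beta1 *\<^sub>R m + (1 - beta1) *\<^sub>R zo_grad g mu x (gdir \<omega> t)
      in (x - eta *\<^sub>R (matrix_inv P *v m'), m'))"

definition crit_mean :: "(real^'n \<Rightarrow> real) \<Rightarrow> real^'n^'n \<Rightarrow> real \<Rightarrow> real \<Rightarrow> real^'n \<Rightarrow> ereal" where
  "crit_mean g P mu beta1 xstar = Sup (ereal ` {eta. eta > 0 \<and>
     (\<forall>x0. \<exists>B. \<forall>t. norm (\<integral>\<omega>. (fst (zo_adam g P mu beta1 eta x0 \<omega> t) - xstar) \<partial>gauss_space) \<le> B)})"

text \<open>Mean-square critical step size (expectation as a nonnegative integral, so it may be infinite).\<close>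
definition crit_ms :: "(real^'n \<Rightarrow> real) \<Rightarrow> real^'n^'n \<Rightarrow> real \<Rightarrow> real \<Rightarrow> real^'n \<Rightarrow> ereal" where
  "crit_ms g P mu beta1 xstar = Sup (ereal ` {eta. eta > 0 \<and>
     (\<forall>x0. \<exists>B::real. \<forall>t. (\<integral>\<^sup>+\<omega>. ennreal ((norm (fst (zo_adam g P mu beta1 eta x0 \<omega> t) - xstar))\<^sup>2) \<partial>gauss_space) \<le> ennreal B)})"

end

theory Submission
  imports Defs
begin

text \<open>The Hessian is symmetric, so the two-point estimator on the quadratic model is \<open>u u\<^sup>T H z\<close> with
  \<open>z = x - x\<^sup>\<star>\<close>, and \<open>P\<^sup>-\<^sup>1 H\<close> has a \<open>P\<close>-orthonormal eigenbasis. Taking expectations, each eigencoordinate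
  of the mean follows the heavy-ball recursion with characteristic polynomial
  \<open>r\<^sup>2 - (1 + \<beta> - \<eta> (1 - \<beta>) \<lambda>) r + \<beta>\<close>, whose roots leave the unit disc exactly when
  \<open>\<eta> (1 - \<beta>) \<lambda>\<close> exceeds \<open>2 (1 + \<beta>)\<close>.

  If \<open>P\<close> and \<open>H\<close> commute, the eigenbasis is orthonormal, and by the Gaussian fourth moments the second
  moments of \<open>P z\<close> and of the momentum along each eigenvector form a closed linear recursion. The modes are
  coupled only through the forcing \<open>T = \<Sum>\<^sub>j \<lambda>\<^sub>j\<^sup>2 E(P z)\<^sub>j\<^sup>2\<close>. A suitable linear functional of the moments
  changes in each step by \<open>(\<Sum>\<^sub>i \<eta> \<lambda>\<^sub>i / (2 (1 - \<eta> \<lambda>\<^sub>i / (1 + \<beta>))) - 1) T\<close>, so it is a Lyapunov function when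
  the sum is below one and forces divergence when the sum exceeds one.\<close>

text \<open>Everything spectral rests on the symmetry of \<open>H\<close>, which is extracted from
  twice differentiability. Commutation matters because the conditional second moment of the
  estimator contains the isotropic term |Hz|^2 I: in a Euclidean orthonormal eigenbasis it forces
  all modes equally and splits as a sum over modes, and this closes the recursion.

  No spectral radius of the coupled system is computed. The functional comes from solving, mode by
  mode, the adjoint equations that cancel the momentum and mixed moments. What remains is a loss
  proportional to (1 + \<beta> - \<eta> \<lambda>) \<lambda> times the position moment, and a gain
  proportional to T. So at \<eta> \<lambda> = 1 + \<beta> a mode loses its damping, and from there
  on it diverges by itself. Two obstacles remain: modes with eigenvalue 0 have weight 0 in the
  functional, so their boundedness needs a separate conserved quantity; and growth contradicts
  boundedness only because the functional is dominated by T at two consecutive times. For a supremum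
  it is enough to decide both regimes away from the critical value.\<close>

subsection \<open>Symmetry of the Hessian\<close>

text \<open>The gradient is only known to be differentiable at the single point \<open>x\<close>.
  Hence the mean value theorem is applied once, to the difference of \<open>f\<close> along two
  parallel segments, and the two gradients it produces are replaced by their linearisations at
  \<open>x\<close>.\<close>

lemma second_difference_approx:
  fixes f :: "'a::real_inner \<Rightarrow> real" and g D :: "'a \<Rightarrow> 'a"
  assumes "0 < r"
    and df: "\<And>y. y \<in> ball x r \<Longrightarrow> (f has_derivative (\<lambda>h. g y \<bullet> h)) (at y)"
    and dg: "(g has_derivative D) (at x)"
    and "0 < \<epsilon>"
  shows "\<exists>\<delta>>0. \<forall>t. 0 < t \<and> t < \<delta> \<longrightarrow>
    \<bar>f (x + t *\<^sub>R u + t *\<^sub>R v) - f (x + t *\<^sub>R u) - f (x + t *\<^sub>R v) + f x - t\<^sup>2 * (u \<bullet> D v)\<bar> \<le> \<epsilon> * t\<^sup>2"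
proof -
  have lin: "bounded_linear D" using dg by (rule has_derivative_bounded_linear)
  interpret D: bounded_linear D by fact
  \<comment> \<open>The final error is \<epsilon>/K times t^2 |u| (2|u| + |v|), which is \<epsilon>
    t^2 (K - 1)/K; the summand 1 keeps \<open>K\<close> positive when \<open>u\<close> is 0.\<close>
  define K where "K = norm u * (2 * norm u + norm v) + 1"
  have K: "K > 0" unfolding K_def by (intro add_nonneg_pos mult_nonneg_nonneg) auto
  have "\<epsilon> / K > 0" using K assms by simp
  with dg obtain d where d: "d > 0" and
    dR: "\<And>y. norm (y - x) < d \<Longrightarrow> norm (g y - g x - D (y - x)) \<le> \<epsilon> / K * norm (y - x)"
    unfolding has_derivative_at_alt by metis
  \<comment> \<open>Every point used below differs from \<open>x\<close> by less than t N, so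
    \<open>\<delta>\<close> keeps it both in the ball and in the range of \<open>dR\<close>.\<close>
  define N where "N = norm u + norm v + 1"
  have N: "N > 0" unfolding N_def by (intro add_nonneg_pos) auto
  define \<delta> where "\<delta> = min r d / N"
  have "\<delta> > 0" using d N assms by (simp add: \<delta>_def)
  moreover have "\<bar>f (x + t *\<^sub>R u + t *\<^sub>R v) - f (x + t *\<^sub>R u) - f (x + t *\<^sub>R v) + f x - t\<^sup>2 * (u \<bullet> D v)\<bar> \<le> \<epsilon> * t\<^sup>2"
    if t: "0 < t" "t < \<delta>" for t
  proof -
    have small: "norm (a *\<^sub>R (t *\<^sub>R u) + b *\<^sub>R (t *\<^sub>R v)) < min r d"
      if "0 \<le> a" "a \<le> 1" "0 \<le> b" "b \<le> 1" for a b
    proof -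
      have "norm (a *\<^sub>R (t *\<^sub>R u) + b *\<^sub>R (t *\<^sub>R v)) \<le> a * (t * norm u) + b * (t * norm v)"
        using that t by (intro order_trans[OF norm_triangle_ineq]) simp
      also have "\<dots> \<le> 1 * (t * norm u) + 1 * (t * norm v)"
        using that t by (intro add_mono mult_right_mono) auto
      also have "\<dots> < t * N" using t by (simp add: N_def algebra_simps)
      also have "\<dots> < min r d" using t N by (simp add: \<delta>_def pos_less_divide_eq)
      finally show ?thesis .
    qed
    define \<phi> where "\<phi> \<tau> = f (x + \<tau> *\<^sub>R (t *\<^sub>R u) + t *\<^sub>R v) - f (x + \<tau> *\<^sub>R (t *\<^sub>R u))" for \<tau>
    define \<phi>' where "\<phi>' \<tau> = (g (x + \<tau> *\<^sub>R (t *\<^sub>R u) + t *\<^sub>R v) - g (x + \<tau> *\<^sub>R (t *\<^sub>R u))) \<bullet> (t *\<^sub>R u)" for \<tau>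
    have der: "(\<phi> has_real_derivative \<phi>' \<tau>) (at \<tau>)" if "0 \<le> \<tau>" "\<tau> \<le> 1" for \<tau>
    proof -
      have 1: "x + \<tau> *\<^sub>R (t *\<^sub>R u) + t *\<^sub>R v \<in> ball x r"
        using small[of \<tau> 1] that
        by (simp add: dist_norm norm_minus_commute add.assoc)
          (metis norm_minus_cancel minus_add_distrib uminus_add_conv_diff diff_conv_add_uminus)
      have 2: "x + \<tau> *\<^sub>R (t *\<^sub>R u) \<in> ball x r"
        using small[of \<tau> 0] that by (simp add: dist_norm)
      have "((\<lambda>\<tau>. f (x + \<tau> *\<^sub>R (t *\<^sub>R u) + t *\<^sub>R v)) has_derivative
             (\<lambda>h. g (x + \<tau> *\<^sub>R (t *\<^sub>R u) + t *\<^sub>R v) \<bullet> (h *\<^sub>R (t *\<^sub>R u)))) (at \<tau>)"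
        by (rule has_derivative_compose[where f = "\<lambda>\<tau>. x + \<tau> *\<^sub>R (t *\<^sub>R u) + t *\<^sub>R v" and x = \<tau>, OF _ df[OF 1]])
          (auto intro!: derivative_eq_intros)
      moreover have "((\<lambda>\<tau>. f (x + \<tau> *\<^sub>R (t *\<^sub>R u))) has_derivative
             (\<lambda>h. g (x + \<tau> *\<^sub>R (t *\<^sub>R u)) \<bullet> (h *\<^sub>R (t *\<^sub>R u)))) (at \<tau>)"
        by (rule has_derivative_compose[where f = "\<lambda>\<tau>. x + \<tau> *\<^sub>R (t *\<^sub>R u)" and x = \<tau>, OF _ df[OF 2]])
          (auto intro!: derivative_eq_intros)
      ultimately have "(\<phi> has_derivative (\<lambda>h. g (x + \<tau> *\<^sub>R (t *\<^sub>R u) + t *\<^sub>R v) \<bullet> (h *\<^sub>R (t *\<^sub>R u))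
          - g (x + \<tau> *\<^sub>R (t *\<^sub>R u)) \<bullet> (h *\<^sub>R (t *\<^sub>R u)))) (at \<tau>)"
        unfolding \<phi>_def[abs_def] by (rule has_derivative_diff)
      then show ?thesis
        unfolding has_field_derivative_def
        by (rule has_derivative_eq_rhs) (auto simp: \<phi>'_def fun_eq_iff algebra_simps inner_diff_left)
    qed
    obtain \<xi> where \<xi>: "0 < \<xi>" "\<xi> < 1" "\<phi> 1 - \<phi> 0 = (1 - 0) * \<phi>' \<xi>"
      using MVT2[of 0 1 \<phi> \<phi>'] der by auto
    define p where "p = \<xi> *\<^sub>R (t *\<^sub>R u) + t *\<^sub>R v"
    define q where "q = \<xi> *\<^sub>R (t *\<^sub>R u)"
    have pd: "norm p < d" and qd: "norm q < d"
      using small[of \<xi> 1] small[of \<xi> 0] \<xi> by (auto simp: p_def q_def)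
    have Rp: "norm (g (x + p) - g x - D p) \<le> \<epsilon> / K * norm p" using dR[of "x + p"] pd by simp
    have Rq: "norm (g (x + q) - g x - D q) \<le> \<epsilon> / K * norm q" using dR[of "x + q"] qd by simp
    have "D p - D q = t *\<^sub>R D v" by (simp add: p_def q_def D.add D.scaleR)
    then have eq: "g (x + p) - g (x + q) - t *\<^sub>R D v = (g (x + p) - g x - D p) - (g (x + q) - g x - D q)"
      by (simp add: algebra_simps)
    have "norm (g (x + p) - g (x + q) - t *\<^sub>R D v) \<le> \<epsilon> / K * (norm p + norm q)"
      using Rp Rq norm_triangle_ineq4[of "g (x + p) - g x - D p" "g (x + q) - g x - D q"]
      unfolding eq distrib_left by linarith
    also have "\<dots> \<le> \<epsilon> / K * (t * (2 * norm u + norm v))"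
    proof (intro mult_left_mono)
      have "norm p \<le> \<xi> * (t * norm u) + t * norm v"
        unfolding p_def using \<xi> t by (intro order_trans[OF norm_triangle_ineq]) simp
      moreover have "norm q = \<xi> * (t * norm u)" unfolding q_def using \<xi> t by simp
      moreover have "\<xi> * (t * norm u) \<le> 1 * (t * norm u)" using \<xi> t by (intro mult_right_mono) auto
      ultimately show "norm p + norm q \<le> t * (2 * norm u + norm v)" by (simp add: algebra_simps)
    qed (use K assms in auto)
    finally have R: "norm (g (x + p) - g (x + q) - t *\<^sub>R D v) \<le> \<epsilon> / K * (t * (2 * norm u + norm v))" .
    have "f (x + t *\<^sub>R u + t *\<^sub>R v) - f (x + t *\<^sub>R u) - f (x + t *\<^sub>R v) + f x = \<phi> 1 - \<phi> 0"
      by (simp add: \<phi>_def)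
    also have "\<dots> = (g (x + p) - g (x + q)) \<bullet> (t *\<^sub>R u)"
      using \<xi>(3) by (simp add: \<phi>'_def p_def q_def add.assoc)
    finally have "\<bar>f (x + t *\<^sub>R u + t *\<^sub>R v) - f (x + t *\<^sub>R u) - f (x + t *\<^sub>R v) + f x - t\<^sup>2 * (u \<bullet> D v)\<bar>
        = \<bar>(g (x + p) - g (x + q) - t *\<^sub>R D v) \<bullet> (t *\<^sub>R u)\<bar>"
      by (simp add: inner_diff_left power2_eq_square inner_commute algebra_simps)
    also have "\<dots> \<le> norm (g (x + p) - g (x + q) - t *\<^sub>R D v) * norm (t *\<^sub>R u)"
      by (rule Cauchy_Schwarz_ineq2)
    also have "\<dots> \<le> \<epsilon> / K * (t * (2 * norm u + norm v)) * norm (t *\<^sub>R u)"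
      using R by (intro mult_right_mono) auto
    also have "\<dots> = \<epsilon> * t\<^sup>2 * ((K - 1) / K)"
      using t by (simp add: K_def power2_eq_square algebra_simps)
    also have "\<dots> \<le> \<epsilon> * t\<^sup>2 * 1"
      using K assms by (intro mult_left_mono) auto
    finally show ?thesis by simp
  qed
  ultimately show ?thesis by blast
qed

text \<open>The second difference is symmetric in \<open>u\<close> and \<open>v\<close>, and divided
  by t^2 it tends to either side of the equation.\<close>

lemma symmetric_second_derivative:
  fixes f :: "'a::real_inner \<Rightarrow> real" and g D :: "'a \<Rightarrow> 'a"
  assumes "0 < r"
    and df: "\<And>y. y \<in> ball x r \<Longrightarrow> (f has_derivative (\<lambda>h. g y \<bullet> h)) (at y)"
    and dg: "(g has_derivative D) (at x)"
  shows "u \<bullet> D v = v \<bullet> D u"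
proof -
  have "\<bar>u \<bullet> D v - v \<bullet> D u\<bar> \<le> 0 + e" if "e > 0" for e
  proof -
    let ?S = "\<lambda>t u v. f (x + t *\<^sub>R u + t *\<^sub>R v) - f (x + t *\<^sub>R u) - f (x + t *\<^sub>R v) + f x"
    have e2: "e / 2 > 0" using that by simp
    obtain d1 where d1: "d1 > 0" "\<And>t. 0 < t \<Longrightarrow> t < d1 \<Longrightarrow> \<bar>?S t u v - t\<^sup>2 * (u \<bullet> D v)\<bar> \<le> e/2 * t\<^sup>2"
      using second_difference_approx[OF assms e2, of u v] by blast
    obtain d2 where d2: "d2 > 0" "\<And>t. 0 < t \<Longrightarrow> t < d2 \<Longrightarrow> \<bar>?S t v u - t\<^sup>2 * (v \<bullet> D u)\<bar> \<le> e/2 * t\<^sup>2"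
      using second_difference_approx[OF assms e2, of v u] by blast
    define t where "t = min d1 d2 / 2"
    have t: "0 < t" "t < d1" "t < d2" using d1 d2 by (auto simp: t_def)
    have "?S t u v = ?S t v u" by (simp add: algebra_simps)
    then have "\<bar>t\<^sup>2 * (u \<bullet> D v) - t\<^sup>2 * (v \<bullet> D u)\<bar> \<le> e * t\<^sup>2"
      using d1(2)[of t] d2(2)[of t] t by linarith
    then have "t\<^sup>2 * \<bar>u \<bullet> D v - v \<bullet> D u\<bar> \<le> t\<^sup>2 * e"
      by (simp add: abs_mult right_diff_distrib[symmetric] mult.commute[of e])
    then show ?thesis using t by simp
  qed
  then have "\<bar>u \<bullet> D v - v \<bullet> D u\<bar> \<le> 0" by (rule field_le_epsilon)
  then show ?thesis by simp
qed

subsection \<open>Eigenbases of self-adjoint matrices\<close>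

lemma inner_symmetric_matrix:
  fixes A :: "real^'n^'n"
  assumes "transpose A = A"
  shows "x \<bullet> (A *v y) = (A *v x) \<bullet> y"
  using dot_lmul_matrix[of x A y] assms transpose_matrix_vector[of A x] by simp

text \<open>A null vector minimises the form on \<open>W\<close>, so the linear term of the form at
  \<open>v\<close> must vanish in every direction of \<open>W\<close>.\<close>

lemma psd_null_vector:
  fixes C :: "real^'n^'n"
  assumes sym: "transpose C = C" and W: "subspace W"
    and psd: "\<And>x. x \<in> W \<Longrightarrow> x \<bullet> (C *v x) \<ge> 0"
    and v: "v \<in> W" "v \<bullet> (C *v v) = 0" and x: "x \<in> W"
  shows "x \<bullet> (C *v v) = 0"
proof (rule ccontr)
  define a where "a = x \<bullet> (C *v v)"
  define b where "b = x \<bullet> (C *v x)"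
  assume "x \<bullet> (C *v v) \<noteq> 0"
  then have a: "a \<noteq> 0" by (simp add: a_def)
  have b: "b \<ge> 0" using psd[OF x] by (simp add: b_def)
  \<comment> \<open>The minimiser would be - a / b, but \<open>b\<close> may be 0; with b + 1 the
    value is still negative, namely - a^2 (b + 2) / (b + 1)^2.\<close>
  define \<tau> where "\<tau> = - a / (b + 1)"
  have "v + \<tau> *\<^sub>R x \<in> W" using v x W by (simp add: subspace_add subspace_scale)
  from psd[OF this] have "0 \<le> 2 * \<tau> * a + \<tau>\<^sup>2 * b"
    using v(2) inner_symmetric_matrix[OF sym, of v x]
    by (simp add: matrix_vector_right_distrib inner_add_left inner_add_right a_def b_def
        matrix_vector_mult_scaleR inner_commute power2_eq_square algebra_simps)
  also have "\<dots> = - (a\<^sup>2 * (b + 2)) / (b + 1)\<^sup>2"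
    using b by (simp add: \<tau>_def divide_simps power2_eq_square) algebra
  also have "\<dots> < 0" using a b by (simp add: divide_neg_pos)
  finally show False by simp
qed

text \<open>W V is the Gram matrix of the family for the inner product of \<open>P\<close>; for
  square matrices a left inverse is also a right inverse, which yields completeness of the
  family.\<close>

lemma orthonormal_columns_inverse:
  fixes P :: "real^'n^'n" and v :: "'n \<Rightarrow> real^'n"
  assumes orth: "\<And>i j. v i \<bullet> (P *v v j) = (if i = j then 1 else 0)"
  defines "V \<equiv> \<chi> i j. v j $ i" and "W \<equiv> \<chi> i. v i v* P"
  shows "W ** V = mat 1" "V ** W = mat 1"
proof -
  have "(W ** V) $ i $ j = v i \<bullet> (P *v v j)" for i j
    using dot_lmul_matrix[of "v i" P "v j"]
    by (simp add: matrix_matrix_mult_def W_def V_def inner_vec_def)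
  then show 1: "W ** V = mat 1" by (simp add: vec_eq_iff orth mat_def)
  then show "V ** W = mat 1" by (simp add: matrix_left_right_inverse)
qed

lemma orthonormal_expansion:
  fixes P :: "real^'n^'n" and v :: "'n \<Rightarrow> real^'n"
  assumes orth: "\<And>i j. v i \<bullet> (P *v v j) = (if i = j then 1 else 0)"
  shows "x = (\<Sum>i\<in>UNIV. (v i \<bullet> (P *v x)) *\<^sub>R v i)"
proof -
  define V :: "real^'n^'n" where "V = (\<chi> i j. v j $ i)"
  define W :: "real^'n^'n" where "W = (\<chi> i. v i v* P)"
  have W: "(W *v x) $ i = v i \<bullet> (P *v x)" for i
    using dot_lmul_matrix[of "v i" P x]
    by (simp add: W_def matrix_vector_mul_component)
  have "V ** W = mat 1"
    unfolding V_def W_def by (rule orthonormal_columns_inverse(2)[OF orth])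
  then have "x = V *v (W *v x)" by (simp add: matrix_vector_mul_assoc)
  also have "\<dots> = (\<Sum>i\<in>UNIV. (W *v x) $ i *\<^sub>R v i)"
    by (simp add: matrix_mult_sum column_def V_def scalar_mult_eq_scaleR)
  finally show ?thesis by (simp add: W)
qed

section \<open>Characteristic polynomial and trace in an eigenbasis, and existence of the
  eigenbasis\<close>

lemma poly_charpoly:
  "poly (charpoly A) x = det (mat x - A :: real^'n^'n)"
proof -
  have sgn: "poly (of_int k) x = of_int k" for k by (metis of_int_poly poly_pCons poly_0 mult_zero_right add_0_right)
  show ?thesis
    unfolding charpoly_def det_def poly_sum poly_mult poly_prod sgn
    by (intro sum.cong refl arg_cong2[where f = "(*)"] prod.cong) (auto simp: mat_def)
qed

lemma
  fixes A P :: "real^'n^'n" and v :: "'n \<Rightarrow> real^'n" and d :: "'n \<Rightarrow> real"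
  assumes orth: "\<And>i j. v i \<bullet> (P *v v j) = (if i = j then 1 else 0)"
    and eig: "\<And>i. A *v v i = d i *\<^sub>R v i"
  shows charpoly_eigenbasis: "charpoly A = (\<Prod>i\<in>UNIV. [:- d i, 1:])"
    and trace_eigenbasis: "trace A = (\<Sum>i\<in>UNIV. d i)"
proof -
  define V :: "real^'n^'n" where "V = (\<chi> i j. v j $ i)"
  define W :: "real^'n^'n" where "W = (\<chi> i. v i v* P)"
  define D :: "real^'n^'n" where "D = (\<chi> i j. if i = j then d i else 0)"
  have WV: "W ** V = mat 1" and VW: "V ** W = mat 1"
    unfolding V_def W_def by (rule orthonormal_columns_inverse[OF orth])+
  have "(A ** V) $ i $ j = (V ** D) $ i $ j" for i j
  proof -
    have "(A ** V) $ i $ j = (A *v v j) $ i"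
      by (simp add: matrix_matrix_mult_def matrix_vector_mult_def V_def)
    also have "\<dots> = (V ** D) $ i $ j"
      by (simp add: eig matrix_matrix_mult_def V_def D_def if_distrib cong: if_cong)
    finally show ?thesis .
  qed
  then have AV: "A ** V = V ** D" by (simp add: vec_eq_iff)
  have A: "A = V ** D ** W"
    by (metis AV VW matrix_mul_assoc matrix_mul_rid)
  show "trace A = (\<Sum>i\<in>UNIV. d i)"
  proof -
    have "trace A = trace (W ** (V ** D))" unfolding A by (rule trace_mul_sym)
    also have "W ** (V ** D) = D" by (simp add: matrix_mul_assoc WV)
    finally show ?thesis by (simp add: trace_def D_def)
  qed
  have "poly (charpoly A) x = poly (\<Prod>i\<in>UNIV. [:- d i, 1:]) x" for x
  proof -
    have "mat x ** V = V ** mat x"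
      by (simp add: vec_eq_iff matrix_matrix_mult_def mat_def if_distrib if_distribR mult.commute cong: if_cong)
    then have "(mat x - A) ** V = V ** (mat x - D)"
      using AV by (simp add: vec_eq_iff matrix_matrix_mult_def algebra_simps sum_subtractf)
    then have "det V * det (mat x - A) = det V * det (mat x - D)"
      by (metis det_mul mult.commute)
    moreover have "det V \<noteq> 0" using arg_cong[OF WV, of det] by (auto simp: det_mul)
    ultimately have "det (mat x - A) = det (mat x - D)" by simp
    also have "\<dots> = (\<Prod>i\<in>UNIV. (mat x - D) $ i $ i)"
      by (simp add: det_diagonal mat_def D_def)
    finally show ?thesis by (simp add: poly_charpoly poly_prod mat_def D_def)
  qed
  then show "charpoly A = (\<Prod>i\<in>UNIV. [:- d i, 1:])"
    by (simp add: poly_eq_poly_eq_iff[symmetric] fun_eq_iff)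
qed

text \<open>Both sides have the same multiset of roots. This matches the order of the eigenvalues
  produced by the construction of an eigenbasis with the order prescribed by
  \<open>lam\<close>.\<close>

lemma linear_factors_eq_imp_permutes:
  fixes lam d :: "'n::finite \<Rightarrow> real"
  assumes "(\<Prod>i\<in>UNIV. [:- lam i, 1:]) = (\<Prod>i\<in>UNIV. [:- d i, 1:])"
  obtains p where "bij p" "\<And>i. lam i = d (p i)"
proof -
  have proots: "proots (\<Prod>i\<in>UNIV. [:- f i, 1:]) = image_mset f (mset_set UNIV)" for f :: "'n \<Rightarrow> real"
  proof -
    have "proots (\<Prod>i\<in>UNIV. [:- f i, 1:]) = (\<Sum>i\<in>UNIV. {#f i#})"
      by (subst proots_prod) auto
    also have "\<dots> = image_mset f (mset_set UNIV)"
      by (simp add: sum_unfold_sum_mset image_mset.compositionality)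
    finally show ?thesis .
  qed
  have "image_mset lam (mset_set UNIV) = image_mset d (mset_set UNIV)"
    using assms proots[of lam] proots[of d] by simp
  then obtain p where "p permutes UNIV" "\<forall>i\<in>UNIV. lam i = d (p i)"
    by (rule image_mset_eq_implies_permutes[rotated]) auto
  then show ?thesis using that permutes_bij by blast
qed

text \<open>The spectral theorem for the pencil (B, P), which avoids a square root of
  \<open>P\<close>. Each induction step adds a maximiser of the form of \<open>B\<close> on the
  \<open>P\<close>-unit sphere of the \<open>P\<close>-orthogonal complement of the vectors found so
  far.\<close>

lemma ex_generalized_eigenbasis:
  fixes B P :: "real^'n^'n" and I :: "'n set"
  assumes P_sym: "transpose P = P" and P_pd: "\<forall>v. v \<noteq> 0 \<longrightarrow> v \<bullet> (P *v v) > 0"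
    and B_sym: "transpose B = B"
  shows "\<exists>v d. (\<forall>i\<in>I. \<forall>j\<in>I. v i \<bullet> (P *v v j) = (if i = j then 1 else 0)) \<and>
     (\<forall>i\<in>I. B *v v i = d i *\<^sub>R (P *v v i))"
  using finite[of I]
proof (induction I rule: finite_induct)
  case empty
  show ?case by simp
next
  case (insert k I)
  then obtain v d where
    orth: "\<And>i j. i \<in> I \<Longrightarrow> j \<in> I \<Longrightarrow> v i \<bullet> (P *v v j) = (if i = j then 1 else 0)" and
    eig: "\<And>i. i \<in> I \<Longrightarrow> B *v v i = d i *\<^sub>R (P *v v i)" by blast
  define W where "W = {x. \<forall>i\<in>I. x \<bullet> (P *v v i) = 0}"
  have W: "subspace W"
    by (auto simp: W_def subspace_def inner_add_left)
  \<comment> \<open>As \<open>k\<close> lies outside \<open>I\<close>, fewer vectors than the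
    dimension have been chosen, so \<open>W\<close> contains a nonzero vector.\<close>
  have "card I < CARD('n)"
    using insert(2) by (intro psubset_card_mono) auto
  then have "dim ((\<lambda>i. P *v v i) ` I) < DIM(real^'n)"
    using dim_le_card'[of "(\<lambda>i. P *v v i) ` I"] card_image_le[of I "\<lambda>i. P *v v i"] by simp
  then obtain x0 where x0: "x0 \<noteq> 0" "\<And>y. y \<in> span ((\<lambda>i. P *v v i) ` I) \<Longrightarrow> orthogonal x0 y"
    by (rule orthogonal_to_subspace_exists) blast
  then have x0W: "x0 \<in> W" by (auto simp: W_def orthogonal_def span_base)
  define q where "q = (\<lambda>x. x \<bullet> (P *v x))"
  have contq: "continuous_on S q" for S
    unfolding q_def by (intro continuous_intros linear_continuous_on linear_linear[THEN iffD1]) auto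
  have contb: "continuous_on S (\<lambda>x. x \<bullet> (B *v x))" for S
    by (intro continuous_intros linear_continuous_on linear_linear[THEN iffD1]) auto
  have q_scale: "q (c *\<^sub>R x) = c\<^sup>2 * q x" for c x
    by (simp add: q_def matrix_vector_mult_scaleR power2_eq_square)
  have "compact (sphere (0::real^'n) 1)" by simp
  moreover have "sphere (0::real^'n) 1 \<noteq> {}" by simp
  ultimately obtain s0 where s0: "s0 \<in> sphere 0 1" "\<And>x. x \<in> sphere 0 1 \<Longrightarrow> q s0 \<le> q x"
    using continuous_attains_inf[of "sphere 0 1" q] contq by blast
  have "s0 \<noteq> 0" using s0(1) by auto
  then have c0: "q s0 > 0" using P_pd by (simp add: q_def)
  \<comment> \<open>The minimum of \<open>q\<close> on the Euclidean unit sphere is positive; this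
    bounds \<open>S\<close>, so the maximiser below exists by compactness.\<close>
  have coercive: "q s0 * (norm x)\<^sup>2 \<le> q x" for x
  proof (cases "x = 0")
    case False
    then have "q s0 \<le> q ((1 / norm x) *\<^sub>R x)" by (intro s0(2)) simp
    then show ?thesis using False by (simp add: q_scale power_divide divide_simps)
  qed (simp add: q_def)
  define S where "S = {x \<in> W. q x = 1}"
  have "closed S"
  proof -
    have "S = W \<inter> q -` {1}" by (auto simp: S_def)
    then show ?thesis
      using closed_subspace[OF W] continuous_closed_preimage[OF contq, of UNIV "{1}"]
      by (simp add: closed_Int)
  qed
  moreover have "bounded S"
  proof (rule boundedI)
    fix x assume "x \<in> S"
    then have "q s0 * (norm x)\<^sup>2 \<le> 1" using coercive[of x] by (simp add: S_def)
    then have "(norm x)\<^sup>2 \<le> 1 / q s0" using c0 by (simp add: field_simps)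
    then show "norm x \<le> sqrt (1 / q s0)" by (rule real_le_rsqrt)
  qed
  ultimately have "compact S" by (simp add: compact_eq_bounded_closed)
  moreover have normalise: "(1 / sqrt (q x)) *\<^sub>R x \<in> S" if "x \<in> W" "x \<noteq> 0" for x
  proof -
    have "q x > 0" using that P_pd by (simp add: q_def)
    then show ?thesis using that W by (simp add: S_def subspace_scale q_scale power_divide)
  qed
  then have "S \<noteq> {}" using x0 x0W by blast
  ultimately obtain w where w: "w \<in> S" "\<And>x. x \<in> S \<Longrightarrow> x \<bullet> (B *v x) \<le> w \<bullet> (B *v w)"
    using continuous_attains_sup[of S "\<lambda>x. x \<bullet> (B *v x)"] contb by blast
  define e where "e = w \<bullet> (B *v w)"
  \<comment> \<open>\<open>e\<close> is the largest value of the Rayleigh quotient on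
    \<open>W\<close>, so the form of \<open>C\<close> is nonnegative on \<open>W\<close> and
    vanishes at \<open>w\<close>.\<close>
  define C where "C = e *\<^sub>R P - B"
  have Cv: "C *v x = e *\<^sub>R (P *v x) - B *v x" for x
    by (simp add: C_def matrix_vector_mult_diff_rdistrib scaleR_matrix_vector_assoc)
  have C_sym: "transpose C = C"
    using P_sym B_sym by (simp add: C_def transpose_def vec_eq_iff)
  have wW: "w \<in> W" "w \<bullet> (P *v w) = 1" using w by (auto simp: S_def q_def)
  have Cpsd: "x \<bullet> (C *v x) \<ge> 0" if "x \<in> W" for x
  proof (cases "x = 0")
    case False
    then have "q x > 0" using P_pd by (simp add: q_def)
    moreover have "x \<bullet> (B *v x) / q x \<le> e"
      using w(2)[OF normalise[OF that False]] \<open>q x > 0\<close>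
      by (simp add: e_def matrix_vector_mult_scaleR)
    ultimately show ?thesis
      by (simp add: Cv inner_diff_right q_def divide_simps split: if_splits)
  qed simp
  have Cw0: "w \<bullet> (C *v w) = 0" by (simp add: Cv inner_diff_right wW e_def)
  have CwW: "x \<bullet> (C *v w) = 0" if "x \<in> W" for x
    by (rule psd_null_vector[OF C_sym W Cpsd wW(1) Cw0 that])
  have wv: "w \<bullet> (P *v v i) = 0" "v i \<bullet> (P *v w) = 0" if "i \<in> I" for i
    using wW(1) that inner_symmetric_matrix[OF P_sym, of "v i" w]
    by (auto simp: W_def inner_commute)
  have Cwv: "v i \<bullet> (C *v w) = 0" if "i \<in> I" for i
    using that inner_symmetric_matrix[OF B_sym, of "v i" w] wv[OF that]
    by (simp add: Cv inner_diff_right eig inner_commute)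
  \<comment> \<open>Subtracting the \<open>P\<close>-projection onto the earlier vectors moves
    \<open>x\<close> into \<open>W\<close>. The projection itself contributes nothing, because the
    earlier vectors solve the pencil equation and are \<open>P\<close>-orthogonal to
    \<open>w\<close>.\<close>
  have "x \<bullet> (C *v w) = 0" for x
  proof -
    define y where "y = x - (\<Sum>i\<in>I. (x \<bullet> (P *v v i)) *\<^sub>R v i)"
    have "y \<bullet> (P *v v j) = 0" if "j \<in> I" for j
    proof -
      have "(\<Sum>i\<in>I. (x \<bullet> (P *v v i)) * (v i \<bullet> (P *v v j))) = (\<Sum>i\<in>I. if i = j then x \<bullet> (P *v v i) else 0)"
        using that by (intro sum.cong) (auto simp: orth)
      then show ?thesis using that insert(1)
        by (simp add: y_def inner_diff_left inner_sum_left)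
    qed
    then have "y \<bullet> (C *v w) = 0" by (intro CwW) (simp add: W_def)
    moreover have "(\<Sum>i\<in>I. (x \<bullet> (P *v v i)) *\<^sub>R v i) \<bullet> (C *v w) = 0"
      by (simp add: inner_sum_left Cwv)
    moreover have "x \<bullet> (C *v w) = y \<bullet> (C *v w) + (\<Sum>i\<in>I. (x \<bullet> (P *v v i)) *\<^sub>R v i) \<bullet> (C *v w)"
      by (simp add: y_def inner_diff_left)
    ultimately show ?thesis by simp
  qed
  then have "C *v w = 0" by (metis inner_eq_zero_iff)
  then have Bw: "B *v w = e *\<^sub>R (P *v w)" by (simp add: Cv)
  show ?case
  proof (intro exI conjI ballI)
    fix i j assume "i \<in> insert k I" "j \<in> insert k I"
    then show "(v(k := w)) i \<bullet> (P *v (v(k := w)) j) = (if i = j then 1 else 0)"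
      using insert(2) by (auto simp: wW wv orth)
  next
    fix i assume "i \<in> insert k I"
    then show "B *v (v(k := w)) i = (d(k := e)) i *\<^sub>R (P *v (v(k := w)) i)"
      using insert(2) by (auto simp: Bw eig)
  qed
qed

text \<open>The hypothesis on \<open>P ** A\<close> says that \<open>A\<close> is self-adjoint for the inner product of \<open>P\<close>.\<close>

lemma ex_eigenbasis:
  fixes A P :: "real^'n^'n" and lam :: "'n \<Rightarrow> real"
  assumes P_sym: "transpose P = P" and P_pd: "\<forall>v. v \<noteq> 0 \<longrightarrow> v \<bullet> (P *v v) > 0"
    and PA_sym: "transpose (P ** A) = P ** A"
    and lam: "charpoly A = (\<Prod>i\<in>UNIV. [:- lam i, 1:])"
  obtains v :: "'n \<Rightarrow> real^'n" where "\<And>i j. v i \<bullet> (P *v v j) = (if i = j then 1 else 0)"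
    "\<And>i. A *v v i = lam i *\<^sub>R v i"
proof -
  obtain v :: "'n \<Rightarrow> real^'n" and d where orth: "\<And>i j. v i \<bullet> (P *v v j) = (if i = j then 1 else 0)"
    and geig: "\<And>i. (P ** A) *v v i = d i *\<^sub>R (P *v v i)"
    using ex_generalized_eigenbasis[OF P_sym P_pd PA_sym, of UNIV] by blast
  have inj: "x = y" if "P *v x = P *v y" for x y
  proof -
    have "(x - y) \<bullet> (P *v (x - y)) = 0" using that by (simp add: matrix_vector_mult_diff_distrib)
    then show ?thesis using P_pd by (metis eq_iff_diff_eq_0 less_irrefl)
  qed
  have eig: "A *v v i = d i *\<^sub>R v i" for i
    by (rule inj) (simp only: matrix_vector_mul_assoc geig matrix_vector_mult_scaleR)
  obtain p where p: "bij p" "\<And>i. lam i = d (p i)"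
    by (rule linear_factors_eq_imp_permutes[OF lam[unfolded charpoly_eigenbasis[OF orth eig], symmetric]]) blast
  show ?thesis
  proof (rule that[of "v \<circ> p"])
    show "(v \<circ> p) i \<bullet> (P *v (v \<circ> p) j) = (if i = j then 1 else 0)" for i j
      using bij_is_inj[OF p(1)] by (simp add: orth inj_eq)
    show "A *v (v \<circ> p) i = lam i *\<^sub>R (v \<circ> p) i" for i by (simp add: eig p)
  qed
qed

subsection \<open>Independence and Gaussian moments\<close>

lemma prob_space_gauss_space: "prob_space gauss_space"
  unfolding gauss_space_def by (intro prob_space_PiM prob_space_normal_density) simp

interpretation gauss: prob_space gauss_space
  by (rule prob_space_gauss_space)

lemma space_gauss_space [simp]: "space gauss_space = UNIV"
  by (simp add: gauss_space_def space_PiM PiE_UNIV_domain)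

lemma prob_gauss_space_UNIV [simp]: "measure gauss_space UNIV = 1"
  using gauss.prob_space by simp

lemma sets_gauss_space: "sets gauss_space = sets (\<Pi>\<^sub>M i\<in>UNIV. borel)"
  unfolding gauss_space_def by (rule sets_PiM_cong) auto

lemma measurable_gauss_space_coordinate [measurable]: "(\<lambda>\<omega>. \<omega> i) \<in> borel_measurable gauss_space"
  unfolding measurable_cong_sets[OF sets_gauss_space refl] by measurable

lemma distr_gauss_space_coordinate:
  "distr gauss_space borel (\<lambda>\<omega>. \<omega> i) = density lborel std_normal_density"
proof -
  have "distr gauss_space borel (\<lambda>\<omega>. \<omega> i) = distr gauss_space (density lborel std_normal_density) (\<lambda>\<omega>. \<omega> i)"
    by (rule distr_cong) auto
  also have "\<dots> = density lborel std_normal_density"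
    unfolding gauss_space_def
    by (rule distr_PiM_component) (auto intro: prob_space_normal_density)
  finally show ?thesis .
qed

lemma indep_vars_gauss_space: "gauss.indep_vars (\<lambda>_. borel) (\<lambda>i \<omega>. \<omega> i) UNIV"
proof (subst gauss.indep_vars_iff_distr_eq_PiM')
  have "distr gauss_space (Pi\<^sub>M UNIV (\<lambda>i. borel)) (\<lambda>x. \<lambda>i\<in>UNIV. x i) = distr gauss_space gauss_space (\<lambda>x. x)"
    by (rule distr_cong) (auto simp: sets_gauss_space)
  also have "\<dots> = gauss_space" by simp
  finally show "distr gauss_space (Pi\<^sub>M UNIV (\<lambda>i. borel)) (\<lambda>x. \<lambda>i\<in>UNIV. x i) =
      Pi\<^sub>M UNIV (\<lambda>i. distr gauss_space borel (\<lambda>\<omega>. \<omega> i))"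
    by (simp add: distr_gauss_space_coordinate) (simp add: gauss_space_def)
qed auto

text \<open>A stand-in for measurability with respect to the coordinates in \<open>K\<close> that
  can be checked rule by rule on a term. Its purpose is \<open>indep_var_depends_on\<close>:
  disjoint index sets give independent variables.\<close>

definition depends_on :: "(nat \<times> 'n::finite) set \<Rightarrow> (((nat \<times> 'n) \<Rightarrow> real) \<Rightarrow> 'b::topological_space) \<Rightarrow> bool" where
  "depends_on K X \<longleftrightarrow> X \<in> borel_measurable gauss_space \<and> (\<forall>\<omega> \<omega>'. (\<forall>i\<in>K. \<omega> i = \<omega>' i) \<longrightarrow> X \<omega> = X \<omega>')"

lemma depends_onI:
  assumes "X \<in> borel_measurable gauss_space"
    and "\<And>\<omega> \<omega>'. (\<And>i. i \<in> K \<Longrightarrow> \<omega> i = \<omega>' i) \<Longrightarrow> X \<omega> = X \<omega>'"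
  shows "depends_on K X"
  using assms unfolding depends_on_def by blast

lemma depends_on_measurable: "depends_on K X \<Longrightarrow> X \<in> borel_measurable gauss_space"
  by (simp add: depends_on_def)

lemma depends_on_mono: "depends_on K X \<Longrightarrow> K \<subseteq> L \<Longrightarrow> depends_on L X"
  unfolding depends_on_def by blast

lemma depends_on_const [intro]: "depends_on K (\<lambda>_. c)"
  by (simp add: depends_on_def)

lemma depends_on_coordinate: "i \<in> K \<Longrightarrow> depends_on K (\<lambda>\<omega>. \<omega> i)"
  by (rule depends_onI) auto

lemma depends_on_continuous:
  fixes h :: "'b::topological_space \<Rightarrow> 'c::topological_space"
  assumes "depends_on K X" "continuous_on UNIV h"
  shows "depends_on K (\<lambda>\<omega>. h (X \<omega>))"
proof (rule depends_onI)
  show "(\<lambda>\<omega>. h (X \<omega>)) \<in> borel_measurable gauss_space"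
    using depends_on_measurable[OF assms(1)] borel_measurable_continuous_onI[OF assms(2)]
    by (rule measurable_compose)
  show "h (X \<omega>) = h (X \<omega>')" if "\<And>i. i \<in> K \<Longrightarrow> \<omega> i = \<omega>' i" for \<omega> \<omega>'
    using that assms(1) unfolding depends_on_def by (metis (mono_tags))
qed

lemma depends_on_continuous2:
  fixes X :: "_ \<Rightarrow> 'b::second_countable_topology" and Y :: "_ \<Rightarrow> 'c::second_countable_topology"
    and h :: "'b \<times> 'c \<Rightarrow> 'd::topological_space"
  assumes "depends_on K X" "depends_on K Y" "continuous_on UNIV h"
  shows "depends_on K (\<lambda>\<omega>. h (X \<omega>, Y \<omega>))"
proof (rule depends_on_continuous[OF _ assms(3)], rule depends_onI)
  show "(\<lambda>\<omega>. (X \<omega>, Y \<omega>)) \<in> borel_measurable gauss_space"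
    using assms by (intro borel_measurable_Pair depends_on_measurable)
  show "(X \<omega>, Y \<omega>) = (X \<omega>', Y \<omega>')" if "\<And>i. i \<in> K \<Longrightarrow> \<omega> i = \<omega>' i" for \<omega> \<omega>'
    using that assms unfolding depends_on_def by (metis (mono_tags))
qed

lemma depends_on_add:
  fixes X Y :: "_ \<Rightarrow> 'b::{second_countable_topology, topological_monoid_add}"
  shows "depends_on K X \<Longrightarrow> depends_on K Y \<Longrightarrow> depends_on K (\<lambda>\<omega>. X \<omega> + Y \<omega>)"
  by (drule (1) depends_on_continuous2[where h = "\<lambda>(x, y). x + y"])
    (auto simp: case_prod_unfold intro!: continuous_intros)

lemma depends_on_mult:
  fixes X Y :: "_ \<Rightarrow> real"
  shows "depends_on K X \<Longrightarrow> depends_on K Y \<Longrightarrow> depends_on K (\<lambda>\<omega>. X \<omega> * Y \<omega>)"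
  by (drule (1) depends_on_continuous2[where h = "\<lambda>(x, y). x * y"])
    (auto simp: case_prod_unfold intro!: continuous_intros)

lemma depends_on_power:
  fixes X :: "_ \<Rightarrow> real"
  shows "depends_on K X \<Longrightarrow> depends_on K (\<lambda>\<omega>. X \<omega> ^ k)"
  by (erule depends_on_continuous) (auto intro!: continuous_intros)

lemma depends_on_inner:
  fixes X :: "_ \<Rightarrow> real^'n"
  shows "depends_on K X \<Longrightarrow> depends_on K (\<lambda>\<omega>. X \<omega> \<bullet> a)"
  by (erule depends_on_continuous) (auto intro!: continuous_intros)

lemma depends_on_sum:
  fixes X :: "'i \<Rightarrow> _ \<Rightarrow> real"
  assumes "\<And>i. i \<in> I \<Longrightarrow> depends_on K (X i)"
  shows "depends_on K (\<lambda>\<omega>. \<Sum>i\<in>I. X i \<omega>)"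
  using assms by (induction I rule: infinite_finite_induct) (auto intro: depends_on_add)

lemma indep_var_depends_on:
  fixes X Y :: "((nat \<times> 'n::finite) \<Rightarrow> real) \<Rightarrow> 'b::topological_space"
  assumes X: "depends_on K X" and Y: "depends_on L Y" and disj: "K \<inter> L = {}"
  shows "gauss.indep_var borel X borel Y"
proof -
  \<comment> \<open>Independence is available for restrictions to \<open>K\<close> and
    \<open>L\<close>, which live on smaller product spaces. \<open>emb\<close> returns to full
    sample points by filling in 0; the fill value is immaterial, since the variable reads only the
    coordinates in its own set.\<close>
  define emb :: "(nat \<times> 'n) set \<Rightarrow> ((nat \<times> 'n) \<Rightarrow> real) \<Rightarrow> (nat \<times> 'n) \<Rightarrow> real"
    where "emb = (\<lambda>K \<omega> i. if i \<in> K then \<omega> i else 0)"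
  have emb: "emb K \<in> measurable (Pi\<^sub>M K (\<lambda>_. borel)) gauss_space" for K
    unfolding measurable_cong_sets[OF refl sets_gauss_space]
  proof (rule measurable_PiM_single')
    fix i
    show "(\<lambda>\<omega>. emb K \<omega> i) \<in> borel_measurable (Pi\<^sub>M K (\<lambda>_. borel))"
      by (cases "i \<in> K") (auto simp: emb_def)
  qed (auto simp: space_PiM)
  have eq: "Z \<circ> emb K \<circ> (\<lambda>\<omega>. restrict (\<lambda>i. \<omega> i) K) = Z" if "depends_on K Z"
    for K and Z :: "((nat \<times> 'n) \<Rightarrow> real) \<Rightarrow> 'e::topological_space"
  proof
    fix \<omega>
    show "(Z \<circ> emb K \<circ> (\<lambda>\<omega>. restrict (\<lambda>i. \<omega> i) K)) \<omega> = Z \<omega>"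
      using that unfolding depends_on_def o_def by (elim conjE allE impE) (auto simp: emb_def)
  qed
  have "gauss.indep_var (Pi\<^sub>M K (\<lambda>_. borel)) (\<lambda>\<omega>. restrict (\<lambda>i. \<omega> i) K) (Pi\<^sub>M L (\<lambda>_. borel)) (\<lambda>\<omega>. restrict (\<lambda>i. \<omega> i) L)"
    by (rule gauss.indep_var_restrict[OF indep_vars_gauss_space disj]) auto
  then have "gauss.indep_var borel ((X \<circ> emb K) \<circ> (\<lambda>\<omega>. restrict (\<lambda>i. \<omega> i) K)) borel ((Y \<circ> emb L) \<circ> (\<lambda>\<omega>. restrict (\<lambda>i. \<omega> i) L))"
    by (rule gauss.indep_var_compose)
      (use emb X Y in \<open>auto intro!: measurable_comp dest: depends_on_measurable\<close>)
  then show ?thesis by (simp only: eq[OF X] eq[OF Y])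
qed

lemma has_bochner_integral_mult_depends_on:
  fixes X Y :: "((nat \<times> 'n::finite) \<Rightarrow> real) \<Rightarrow> real"
  assumes "depends_on K X" "depends_on L Y" "K \<inter> L = {}"
    and "has_bochner_integral gauss_space X x" "has_bochner_integral gauss_space Y y"
  shows "has_bochner_integral gauss_space (\<lambda>\<omega>. X \<omega> * Y \<omega>) (x * y)"
  using gauss.indep_var_integrable[OF indep_var_depends_on[OF assms(1-3)]]
    gauss.indep_var_lebesgue_integral[OF indep_var_depends_on[OF assms(1-3)]] assms(4,5)
  by (auto simp: has_bochner_integral_iff)

section \<open>Moments of Gaussian linear forms up to order four\<close>

lemma gauss_coordinate_moment:
  "has_bochner_integral gauss_space (\<lambda>\<omega>. \<omega> i ^ k) (\<integral>x. x ^ k \<partial>density lborel std_normal_density)"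
  using integrable_std_normal_distribution_moment[of k]
  unfolding distr_gauss_space_coordinate[symmetric, of i] has_bochner_integral_iff
  by (auto simp: integrable_distr_eq integral_distr)

lemma gauss_coordinate_moments:
  "has_bochner_integral gauss_space (\<lambda>\<omega>. \<omega> i) 0"
  "has_bochner_integral gauss_space (\<lambda>\<omega>. (\<omega> i)\<^sup>2) 1"
  "has_bochner_integral gauss_space (\<lambda>\<omega>. \<omega> i ^ 3) 0"
  "has_bochner_integral gauss_space (\<lambda>\<omega>. \<omega> i ^ 4) 3"
  using gauss_coordinate_moment[of i 1] gauss_coordinate_moment[of i 2]
    gauss_coordinate_moment[of i 3] gauss_coordinate_moment[of i 4]
    std_normal_distribution_even_moments(1)[of 1] std_normal_distribution_even_moments(1)[of 2]
    integral_std_normal_distribution_moment_odd[of 1] integral_std_normal_distribution_moment_odd[of 3]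
  by (simp_all add: fact_numeral)

text \<open>The form is centred Gaussian with variance \<open>q J\<close>. Adding one independent
  coordinate and expanding the fourth power calls for all lower moments, so the four are carried
  through the induction together.\<close>

lemma gauss_linear_form_moments:
  fixes a :: "'n::finite \<Rightarrow> real" and J :: "'n set" and t :: nat
  defines "S \<equiv> \<lambda>J \<omega>. \<Sum>j\<in>J. a j * \<omega> (t, j)" and "q \<equiv> \<lambda>J. \<Sum>j\<in>J. (a j)\<^sup>2"
  shows "has_bochner_integral gauss_space (S J) 0
    \<and> has_bochner_integral gauss_space (\<lambda>\<omega>. (S J \<omega>)\<^sup>2) (q J)
    \<and> has_bochner_integral gauss_space (\<lambda>\<omega>. S J \<omega> ^ 3) 0
    \<and> has_bochner_integral gauss_space (\<lambda>\<omega>. S J \<omega> ^ 4) (3 * (q J)\<^sup>2)"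
  using finite[of J]
proof (induction J rule: finite_induct)
  case empty
  show ?case by (simp add: S_def q_def has_bochner_integral_zero)
next
  case (insert k J)
  let ?w = "\<lambda>\<omega>. \<omega> (t, k)"
  have dS: "depends_on ({t} \<times> J) (S J)"
    unfolding S_def by (intro depends_on_sum depends_on_mult depends_on_coordinate) auto
  have dw: "depends_on ({t} \<times> {k}) ?w" by (intro depends_on_coordinate) auto
  have disj: "({t} \<times> J) \<inter> ({t} \<times> {k}) = {}" using insert by auto
  note S = insert.IH[THEN conjunct1] insert.IH[THEN conjunct2, THEN conjunct1]
    insert.IH[THEN conjunct2, THEN conjunct2, THEN conjunct1]
    insert.IH[THEN conjunct2, THEN conjunct2, THEN conjunct2]
  note w = gauss_coordinate_moments[of "(t, k)"]
  note dSp = dS depends_on_power[OF dS, of 2] depends_on_power[OF dS, of 3]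
  note dwp = dw depends_on_power[OF dw, of 2] depends_on_power[OF dw, of 3]
  have m11: "has_bochner_integral gauss_space (\<lambda>\<omega>. S J \<omega> * ?w \<omega>) (0 * 0)"
    by (rule has_bochner_integral_mult_depends_on[OF dSp(1) dwp(1) disj S(1) w(1)])
  have m21: "has_bochner_integral gauss_space (\<lambda>\<omega>. (S J \<omega>)\<^sup>2 * ?w \<omega>) (q J * 0)"
    by (rule has_bochner_integral_mult_depends_on[OF dSp(2) dwp(1) disj S(2) w(1)])
  have m12: "has_bochner_integral gauss_space (\<lambda>\<omega>. S J \<omega> * (?w \<omega>)\<^sup>2) (0 * 1)"
    by (rule has_bochner_integral_mult_depends_on[OF dSp(1) dwp(2) disj S(1) w(2)])
  have m31: "has_bochner_integral gauss_space (\<lambda>\<omega>. S J \<omega> ^ 3 * ?w \<omega>) (0 * 0)"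
    by (rule has_bochner_integral_mult_depends_on[OF dSp(3) dwp(1) disj S(3) w(1)])
  have m22: "has_bochner_integral gauss_space (\<lambda>\<omega>. (S J \<omega>)\<^sup>2 * (?w \<omega>)\<^sup>2) (q J * 1)"
    by (rule has_bochner_integral_mult_depends_on[OF dSp(2) dwp(2) disj S(2) w(2)])
  have m13: "has_bochner_integral gauss_space (\<lambda>\<omega>. S J \<omega> * ?w \<omega> ^ 3) (0 * 0)"
    by (rule has_bochner_integral_mult_depends_on[OF dSp(1) dwp(3) disj S(1) w(3)])
  have S_ins: "S (insert k J) = (\<lambda>\<omega>. S J \<omega> + a k * ?w \<omega>)" and q_ins: "q (insert k J) = q J + (a k)\<^sup>2"
    using insert by (auto simp: S_def q_def fun_eq_iff)
  note I = has_bochner_integral_add has_bochner_integral_mult_right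
  have "has_bochner_integral gauss_space (\<lambda>\<omega>. S J \<omega> + a k * ?w \<omega>) (0 + a k * 0)"
    by (intro I S w)
  moreover have "has_bochner_integral gauss_space (\<lambda>\<omega>. (S J \<omega>)\<^sup>2 + (2 * a k) * (S J \<omega> * ?w \<omega>) + (a k)\<^sup>2 * (?w \<omega>)\<^sup>2)
     (q J + (2 * a k) * (0 * 0) + (a k)\<^sup>2 * 1)"
    by (intro I S w m11)
  moreover have "has_bochner_integral gauss_space (\<lambda>\<omega>. S J \<omega> ^ 3 + (3 * a k) * ((S J \<omega>)\<^sup>2 * ?w \<omega>)
      + (3 * (a k)\<^sup>2) * (S J \<omega> * (?w \<omega>)\<^sup>2) + a k ^ 3 * ?w \<omega> ^ 3)
     (0 + (3 * a k) * (q J * 0) + (3 * (a k)\<^sup>2) * (0 * 1) + a k ^ 3 * 0)"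
    by (intro I S w m21 m12)
  moreover have "has_bochner_integral gauss_space (\<lambda>\<omega>. S J \<omega> ^ 4 + (4 * a k) * (S J \<omega> ^ 3 * ?w \<omega>)
      + (6 * (a k)\<^sup>2) * ((S J \<omega>)\<^sup>2 * (?w \<omega>)\<^sup>2) + (4 * a k ^ 3) * (S J \<omega> * ?w \<omega> ^ 3) + a k ^ 4 * ?w \<omega> ^ 4)
     (3 * (q J)\<^sup>2 + (4 * a k) * (0 * 0) + (6 * (a k)\<^sup>2) * (q J * 1) + (4 * a k ^ 3) * (0 * 0) + a k ^ 4 * 3)"
    by (intro I S w m31 m22 m13)
  ultimately show ?case
    unfolding S_ins q_ins
    by (simp add: algebra_simps power2_eq_square power3_eq_cube power4_eq_xxxx)
qed

lemma inner_gdir: "gdir \<omega> t \<bullet> a = (\<Sum>j\<in>UNIV. a $ j * \<omega> (t, j))"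
  by (simp add: gdir_def inner_vec_def mult.commute)

lemma
  shows gdir_second_moment: "has_bochner_integral gauss_space (\<lambda>\<omega>. (gdir \<omega> t \<bullet> a)\<^sup>2) (a \<bullet> a)"
    and gdir_fourth_moment: "has_bochner_integral gauss_space (\<lambda>\<omega>. (gdir \<omega> t \<bullet> a) ^ 4) (3 * (a \<bullet> a)\<^sup>2)"
  using gauss_linear_form_moments[where t = t and a = "\<lambda>j. a $ j" and J = UNIV]
  by (simp_all add: inner_gdir) (simp_all add: inner_vec_def power2_eq_square)

text \<open>Polarisation of \<open>gdir_second_moment\<close>.\<close>

lemma gdir_covariance:
  "has_bochner_integral gauss_space (\<lambda>\<omega>. (gdir \<omega> t \<bullet> a) * (gdir \<omega> t \<bullet> b)) (a \<bullet> b)"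
proof -
  have "has_bochner_integral gauss_space
      (\<lambda>\<omega>. (1/4) * (gdir \<omega> t \<bullet> (a + b))\<^sup>2 - (1/4) * (gdir \<omega> t \<bullet> (a - b))\<^sup>2)
      ((1/4) * ((a + b) \<bullet> (a + b)) - (1/4) * ((a - b) \<bullet> (a - b)))"
    by (intro has_bochner_integral_diff has_bochner_integral_mult_right gdir_second_moment)
  then show ?thesis
    by (simp add: inner_add_left inner_add_right inner_diff_left inner_diff_right
        power2_eq_square field_simps inner_commute)
qed

text \<open>An instance of the Isserlis (Wick) formula, by polarising twice: first (x + y)^4 + (x -
  y)^4 - 2 x^4 - 2 y^4 = 12 x^2 y^2 splits the fourth moment into squares, then the square of
  \<open>a\<close> is polarised into \<open>a\<close> and \<open>b\<close>.\<close>

lemma gdir_mixed_fourth_moment: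
  "has_bochner_integral gauss_space (\<lambda>\<omega>. (gdir \<omega> t \<bullet> a) * (gdir \<omega> t \<bullet> b) * (gdir \<omega> t \<bullet> c)\<^sup>2)
    ((a \<bullet> b) * (c \<bullet> c) + 2 * (a \<bullet> c) * (b \<bullet> c))"
proof -
  have sq: "has_bochner_integral gauss_space (\<lambda>\<omega>. (gdir \<omega> t \<bullet> a)\<^sup>2 * (gdir \<omega> t \<bullet> c)\<^sup>2)
      ((a \<bullet> a) * (c \<bullet> c) + 2 * (a \<bullet> c)\<^sup>2)" for a
  proof -
    have "has_bochner_integral gauss_space
        (\<lambda>\<omega>. (1/12) * ((gdir \<omega> t \<bullet> (a + c)) ^ 4 + (gdir \<omega> t \<bullet> (a - c)) ^ 4
          - 2 * (gdir \<omega> t \<bullet> a) ^ 4 - 2 * (gdir \<omega> t \<bullet> c) ^ 4))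
        ((1/12) * (3 * ((a + c) \<bullet> (a + c))\<^sup>2 + 3 * ((a - c) \<bullet> (a - c))\<^sup>2
          - 2 * (3 * (a \<bullet> a)\<^sup>2) - 2 * (3 * (c \<bullet> c)\<^sup>2)))"
      by (intro has_bochner_integral_diff has_bochner_integral_add has_bochner_integral_mult_right
          gdir_fourth_moment)
    moreover have "(1/12) * ((x + y) ^ 4 + (x - y) ^ 4 - 2 * x ^ 4 - 2 * y ^ 4) = x\<^sup>2 * y\<^sup>2" for x y :: real
      by (simp add: power2_eq_square power4_eq_xxxx algebra_simps)
    moreover have "(1/12) * (3 * ((a + c) \<bullet> (a + c))\<^sup>2 + 3 * ((a - c) \<bullet> (a - c))\<^sup>2
          - 2 * (3 * (a \<bullet> a)\<^sup>2) - 2 * (3 * (c \<bullet> c)\<^sup>2)) = (a \<bullet> a) * (c \<bullet> c) + 2 * (a \<bullet> c)\<^sup>2"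
      by (simp add: inner_add_left inner_add_right inner_diff_left inner_diff_right inner_commute[of c a]
          power2_eq_square algebra_simps)
    ultimately show ?thesis by (simp only: inner_add_right inner_diff_right)
  qed
  have "has_bochner_integral gauss_space
      (\<lambda>\<omega>. (1/4) * ((gdir \<omega> t \<bullet> (a + b))\<^sup>2 * (gdir \<omega> t \<bullet> c)\<^sup>2) - (1/4) * ((gdir \<omega> t \<bullet> (a - b))\<^sup>2 * (gdir \<omega> t \<bullet> c)\<^sup>2))
      ((1/4) * (((a + b) \<bullet> (a + b)) * (c \<bullet> c) + 2 * ((a + b) \<bullet> c)\<^sup>2)
        - (1/4) * (((a - b) \<bullet> (a - b)) * (c \<bullet> c) + 2 * ((a - b) \<bullet> c)\<^sup>2))"
    by (intro has_bochner_integral_diff has_bochner_integral_mult_right sq)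
  moreover have "(1/4) * (((a + b) \<bullet> (a + b)) * (c \<bullet> c) + 2 * ((a + b) \<bullet> c)\<^sup>2)
        - (1/4) * (((a - b) \<bullet> (a - b)) * (c \<bullet> c) + 2 * ((a - b) \<bullet> c)\<^sup>2)
      = (a \<bullet> b) * (c \<bullet> c) + 2 * (a \<bullet> c) * (b \<bullet> c)"
    by (simp add: inner_add_left inner_add_right inner_diff_left inner_diff_right inner_commute[of b a]
        power2_eq_square algebra_simps)
  moreover have "(1/4) * ((x + y)\<^sup>2 * z\<^sup>2) - (1/4) * ((x - y)\<^sup>2 * z\<^sup>2) = x * y * z\<^sup>2" for x y z :: real
    by (simp add: power2_eq_square algebra_simps)
  ultimately show ?thesis by (simp only: inner_add_right inner_diff_right)
qed

lemma depends_on_gdir: "depends_on ({t} \<times> UNIV) (\<lambda>\<omega>. gdir \<omega> t \<bullet> a)"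
  unfolding inner_gdir by (intro depends_on_sum depends_on_mult depends_on_coordinate) auto

subsection \<open>The deterministic moment recursions\<close>

text \<open>The recursion is factored instead of solved, so a double root needs no special
  treatment: z(t+1) - r1 z(t) is geometric with ratio \<open>r2\<close>, and \<open>z\<close> is
  then a contraction by \<open>r1\<close> with bounded input.\<close>

lemma second_order_recursion_bounded:
  fixes z :: "nat \<Rightarrow> complex"
  assumes r: "norm r1 < 1" "norm r2 \<le> 1"
    and z: "\<And>t. z (Suc (Suc t)) = (r1 + r2) * z (Suc t) - r1 * r2 * z t"
  shows "\<exists>B. \<forall>t. norm (z t) \<le> B"
proof -
  define u where "u t = z (Suc t) - r1 * z t" for t
  have "u (Suc t) = r2 * u t" for t
    by (simp add: u_def z algebra_simps)
  then have u: "norm (u t) \<le> norm (u 0)" for t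
  proof (induction t)
    case (Suc t)
    then have "norm (u (Suc t)) = norm r2 * norm (u t)" by (simp add: norm_mult)
    also have "\<dots> \<le> 1 * norm (u t)" using r by (intro mult_right_mono) auto
    finally show ?case using Suc by simp
  qed simp
  \<comment> \<open>The second entry is the fixed point of B = |r1| B + |u 0|.\<close>
  define B where "B = max (norm (z 0)) (norm (u 0) / (1 - norm r1))"
  have "norm (z t) \<le> B" for t
  proof (induction t)
    case (Suc t)
    have "norm (u 0) \<le> (1 - norm r1) * B"
    proof -
      have "norm (u 0) / (1 - norm r1) \<le> B" by (simp add: B_def)
      then show ?thesis using r by (simp add: pos_divide_le_eq mult.commute)
    qed
    moreover have "norm (z (Suc t)) \<le> norm r1 * norm (z t) + norm (u t)"
      using norm_triangle_ineq[of "r1 * z t" "u t"] by (simp add: u_def norm_mult)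
    moreover have "norm r1 * norm (z t) \<le> norm r1 * B" using Suc by (intro mult_left_mono) auto
    ultimately show ?case using u[of t] by (simp add: algebra_simps)
  qed (simp add: B_def)
  then show ?thesis by blast
qed

text \<open>The Jury criterion for r^2 - p r + \<beta>: complex roots have modulus sqrt \<beta>, and
  for real roots |p| < 1 + \<beta> is equivalent to p^2 - 4 \<beta> < (2 - |p|)^2.\<close>

lemma real_second_order_recursion_bounded:
  fixes x :: "nat \<Rightarrow> real"
  assumes "0 \<le> \<beta>" "\<beta> < 1" and p: "\<bar>p\<bar> < 1 + \<beta>"
    and x: "\<And>t. x (Suc (Suc t)) = p * x (Suc t) - \<beta> * x t"
  shows "\<exists>B. \<forall>t. \<bar>x t\<bar> \<le> B"
proof -
  have "\<exists>r1 r2 :: complex. norm r1 < 1 \<and> norm r2 < 1 \<and> r1 + r2 = of_real p \<and> r1 * r2 = of_real \<beta>"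
  proof (cases "p\<^sup>2 \<ge> 4 * \<beta>")
    case True
    define d where "d = sqrt (p\<^sup>2 - 4 * \<beta>)"
    have d: "d \<ge> 0" "d\<^sup>2 = p\<^sup>2 - 4 * \<beta>" using True by (auto simp: d_def)
    have "d\<^sup>2 < (2 - \<bar>p\<bar>)\<^sup>2" unfolding d(2) using p by (simp add: power2_eq_square algebra_simps)
    then have "d < 2 - \<bar>p\<bar>" by (rule power_less_imp_less_base) (use p assms in auto)
    then have "\<bar>(p + d) / 2\<bar> < 1" "\<bar>(p - d) / 2\<bar> < 1" using d(1) by auto
    moreover have "(p + d) / 2 * ((p - d) / 2) = \<beta>" using d(2) by (simp add: algebra_simps power2_eq_square)
    moreover have "(p + d) / 2 + (p - d) / 2 = p" by (simp add: field_simps)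
    ultimately show ?thesis
      by (intro exI[of _ "of_real ((p + d) / 2)"] exI[of _ "of_real ((p - d) / 2)"])
        (auto simp only: norm_of_real of_real_add[symmetric] of_real_mult[symmetric])
  next
    case False
    define d where "d = sqrt (4 * \<beta> - p\<^sup>2)"
    have d: "d\<^sup>2 = 4 * \<beta> - p\<^sup>2" using False by (auto simp: d_def)
    have "norm (Complex (p / 2) (d / 2)) = sqrt \<beta>" "norm (Complex (p / 2) (- d / 2)) = sqrt \<beta>"
      by (simp_all add: complex_norm power_divide d add_divide_distrib[symmetric])
    moreover have "Complex (p / 2) (d / 2) * Complex (p / 2) (- d / 2) = of_real \<beta>"
      using d by (simp add: complex_eq_iff power2_eq_square field_simps)
    moreover have "Complex (p / 2) (d / 2) + Complex (p / 2) (- d / 2) = of_real p"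
      by (simp add: complex_eq_iff)
    ultimately show ?thesis using assms
      by (intro exI[of _ "Complex (p / 2) (d / 2)"] exI[of _ "Complex (p / 2) (- d / 2)"]) simp
  qed
  then obtain r1 r2 :: complex where r: "norm r1 < 1" "norm r2 < 1" "r1 + r2 = of_real p" "r1 * r2 = of_real \<beta>"
    by blast
  have "\<exists>B. \<forall>t. norm (of_real (x t) :: complex) \<le> B"
    using r by (intro second_order_recursion_bounded[of r1 r2]) (auto simp: x)
  then show ?thesis by simp
qed

section \<open>The mean along one eigenvector\<close>

locale heavy_ball_mode =
  fixes \<beta> \<eta> l :: real and z m :: "nat \<Rightarrow> real"
  assumes beta: "0 \<le> \<beta>" "\<beta> < 1" and eta: "0 < \<eta>" and l: "0 \<le> l"
    and m_0: "m 0 = 0"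
    and m_Suc: "\<And>t. m (Suc t) = \<beta> * m t + (1 - \<beta>) * l * z t"
    and z_Suc: "\<And>t. z (Suc t) = z t - \<eta> * m (Suc t)"
begin

text \<open>The momentum is eliminated by reading \<eta> m(t+1) off the position increment.\<close>

lemma second_order:
  "z (Suc (Suc t)) = (1 + \<beta> - \<eta> * (1 - \<beta>) * l) * z (Suc t) - \<beta> * z t"
proof -
  have "z (Suc (Suc t)) = z (Suc t) - \<beta> * (\<eta> * m (Suc t)) - \<eta> * (1 - \<beta>) * l * z (Suc t)"
    by (simp add: z_Suc m_Suc[of "Suc t"] algebra_simps)
  also have "\<eta> * m (Suc t) = z t - z (Suc t)" by (simp add: z_Suc)
  finally show ?thesis by (simp add: algebra_simps)
qed

lemma bounded:
  assumes "\<eta> * (1 - \<beta>) * l < 2 * (1 + \<beta>)"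
  shows "\<exists>B. \<forall>t. \<bar>z t\<bar> \<le> B"
proof (cases "l = 0")
  \<comment> \<open>With eigenvalue 0 the polynomial has the root 1 and the strict criterion fails;
    here the zero initial momentum keeps the position constant.\<close>
  case True
  then have "m t = 0" for t by (induction t) (auto simp: m_0 m_Suc)
  then have "z t = z 0" for t by (induction t) (auto simp: z_Suc)
  then show ?thesis by (metis order_refl)
next
  case False
  then have "\<eta> * (1 - \<beta>) * l > 0" using beta eta l by simp
  then show ?thesis
    using assms beta
    by (intro real_second_order_recursion_bounded[of \<beta> "1 + \<beta> - \<eta> * (1 - \<beta>) * l" z])
      (auto simp only: second_order, auto)
qed

lemma unbounded:
  assumes \<sigma>: "\<eta> * (1 - \<beta>) * l > 2 * (1 + \<beta>)" and z0: "z 0 \<noteq> 0"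
  shows "\<not> (\<forall>t. \<bar>z t\<bar> \<le> B)"
proof
  assume B: "\<forall>t. \<bar>z t\<bar> \<le> B"
  define p where "p = 1 + \<beta> - \<eta> * (1 - \<beta>) * l"
  have p: "p < - (1 + \<beta>)" using \<sigma> by (simp add: p_def)
  have "(1 + \<beta>)\<^sup>2 \<le> (- p)\<^sup>2" using p beta by (intro power_mono) auto
  moreover have "(1 + \<beta>)\<^sup>2 - 4 * \<beta> = (1 - \<beta>)\<^sup>2" by (simp add: power2_eq_square algebra_simps)
  moreover have "(1 - \<beta>)\<^sup>2 > 0" using beta by simp
  ultimately have D: "p\<^sup>2 - 4 * \<beta> > 0" unfolding power2_minus by linarith
  define d where "d = sqrt (p\<^sup>2 - 4 * \<beta>)"
  have d: "d > 0" "d\<^sup>2 = p\<^sup>2 - 4 * \<beta>" using D by (auto simp: d_def)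
  define r1 where "r1 = (p + d) / 2"
  define r2 where "r2 = (p - d) / 2"
  have sum: "r1 + r2 = p" and prod: "r1 * r2 = \<beta>"
    using d by (simp_all add: r1_def r2_def field_simps power2_eq_square)
  have r2: "r2 < -1"
  \<comment> \<open>Comparing squares requires p + 2 to be nonnegative; otherwise p / 2 is already
    below -1.\<close>
  proof (cases "p + 2 \<ge> 0")
    case True
    have "(p + 2)\<^sup>2 < d\<^sup>2" unfolding d(2) using p by (simp add: power2_eq_square algebra_simps)
    then have "p + 2 < d" by (rule power_less_imp_less_base) (use d in auto)
    then show ?thesis by (simp add: r2_def)
  qed (use d in \<open>simp add: r2_def\<close>)
  \<comment> \<open>This combination annihilates the \<open>r1\<close> component, leaving a pure
    power of \<open>r2\<close>. It starts at (r2 - \<beta>) z 0, which is nonzero because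
    \<open>r2\<close> is negative and \<beta> is not.\<close>
  define u where "u t = z (Suc t) - r1 * z t" for t
  have "u (Suc t) = r2 * u t" for t
  proof -
    have "u (Suc t) = (r1 + r2) * z (Suc t) - r1 * r2 * z t - r1 * z (Suc t)"
      unfolding sum prod by (simp add: u_def second_order p_def)
    then show ?thesis by (simp add: u_def algebra_simps)
  qed
  then have u: "u t = r2 ^ t * u 0" for t by (induction t) auto
  have "u 0 = (p - \<beta> - r1) * z 0" by (simp add: u_def z_Suc m_Suc m_0 p_def algebra_simps)
  then have "u 0 = (r2 - \<beta>) * z 0" using sum by simp
  then have u0: "\<bar>u 0\<bar> > 0" using r2 beta z0 by simp
  obtain n where n: "(B + \<bar>r1\<bar> * B) / \<bar>u 0\<bar> < \<bar>r2\<bar> ^ n"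
    using real_arch_pow[of "\<bar>r2\<bar>"] r2 by auto
  have "\<bar>r2\<bar> ^ n * \<bar>u 0\<bar> = \<bar>u n\<bar>" by (simp add: u[of n] abs_mult power_abs)
  also have "\<dots> \<le> \<bar>z (Suc n)\<bar> + \<bar>r1\<bar> * \<bar>z n\<bar>"
    unfolding u_def by (metis abs_mult abs_triangle_ineq4)
  also have "\<dots> \<le> B + \<bar>r1\<bar> * B" using B by (intro add_mono mult_left_mono) auto
  finally show False using n u0 by (simp add: pos_divide_less_eq)
qed

end

section \<open>The coupled recursion of the second moments\<close>

definition gain :: "real \<Rightarrow> real \<Rightarrow> real \<Rightarrow> real" where
  "gain \<beta> \<eta> l = \<eta> * l / (2 * (1 - \<eta> * l / (1 + \<beta>)))"

text \<open>For eigenvalue index \<open>i\<close>, the sequences \<open>a\<close>, \<open>b\<close>, \<open>c\<close> stand for the second moments of the position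
  and of the momentum along the \<open>i\<close>-th eigenvector, and for their mixed moment.\<close>

locale moment_recursion =
  fixes \<beta> \<eta> :: real and lam :: "'n::finite \<Rightarrow> real" and a b c :: "nat \<Rightarrow> 'n \<Rightarrow> real"
  assumes beta: "0 \<le> \<beta>" "\<beta> < 1" and eta: "0 < \<eta>" and lam: "\<And>i. 0 \<le> lam i"
    and a_nonneg: "\<And>t i. 0 \<le> a t i" and b_nonneg: "\<And>t i. 0 \<le> b t i"
    and c_sq: "\<And>t i. (c t i)\<^sup>2 \<le> a t i * b t i"
    and b_0: "\<And>i. b 0 i = 0"
    and b_Suc: "\<And>t i. b (Suc t) i = \<beta>\<^sup>2 * b t i + 2 * \<beta> * (1 - \<beta>) * lam i * c t i
        + (1 - \<beta>)\<^sup>2 * (2 * (lam i)\<^sup>2 * a t i + (\<Sum>j\<in>UNIV. (lam j)\<^sup>2 * a t j))"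
    and c_Suc: "\<And>t i. c (Suc t) i = \<beta> * c t i + (1 - \<beta>) * lam i * a t i - \<eta> * b (Suc t) i"
    and a_Suc: "\<And>t i. a (Suc t) i = a t i - 2 * \<eta> * (\<beta> * c t i + (1 - \<beta>) * lam i * a t i) + \<eta>\<^sup>2 * b (Suc t) i"
begin

definition T :: "nat \<Rightarrow> real" where "T t = (\<Sum>j\<in>UNIV. (lam j)\<^sup>2 * a t j)"

text \<open>Solving the adjoint equations of one mode gives a functional that changes only by a multiple
  of \<open>a\<close> and a multiple of the common forcing \<open>T\<close>; for \<open>lam i = 0\<close> it is proportional to
  the second moment of position minus \<open>\<eta> \<beta> / (1 - \<beta>)\<close> times momentum.\<close>

definition \<phi> :: "nat \<Rightarrow> 'n \<Rightarrow> real" where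
  "\<phi> t i = (1 - \<beta>) * ((1 - \<beta>) * (1 + \<beta>) + 2 * \<beta> * \<eta> * lam i) * a t i + \<eta>\<^sup>2 * \<beta>\<^sup>2 * (1 + \<beta>) * b t i
     - 2 * \<eta> * \<beta> * (1 - \<beta>) * (1 + \<beta> - \<eta> * lam i) * c t i"

abbreviation G :: "'n \<Rightarrow> real" where
  "G i \<equiv> gain \<beta> \<eta> (lam i)"

text \<open>Scaled so that the loss term of \<open>\<phi>_Suc\<close> turns into (lam i)^2 a, the
  summand of \<open>T\<close>; the weight is positive only below the threshold 1 + \<beta>.\<close>

definition w :: "'n \<Rightarrow> real" where
  "w i = lam i / (2 * \<eta> * (1 - \<beta>)\<^sup>2 * (1 + \<beta> - \<eta> * lam i))"

text \<open>The coefficients of \<open>\<phi>\<close> are exactly those for which \<open>b\<close>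
  and \<open>c\<close> drop out of the increment. For a positive eigenvalue the sign of 1 + \<beta>
  - \<eta> lam i decides whether the mode is damped.\<close>

lemma \<phi>_Suc:
  "\<phi> (Suc t) i = \<phi> t i - 2 * \<eta> * (1 - \<beta>)\<^sup>2 * (1 + \<beta> - \<eta> * lam i) * lam i * a t i
     + \<eta>\<^sup>2 * (1 - \<beta>)\<^sup>2 * (1 + \<beta>) * T t"
proof -
  have b: "b (Suc t) i = \<beta>\<^sup>2 * b t i + 2 * \<beta> * (1 - \<beta>) * lam i * c t i
        + (1 - \<beta>)\<^sup>2 * (2 * (lam i)\<^sup>2 * a t i + T t)"
    unfolding T_def by (rule b_Suc)
  show ?thesis
    unfolding \<phi>_def a_Suc[of t i] c_Suc[of t i] b by algebra
qed

lemma T_nonneg: "0 \<le> T t"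
  unfolding T_def by (intro sum_nonneg mult_nonneg_nonneg a_nonneg) auto

lemma lam_sq_le_T: "(lam i)\<^sup>2 * a t i \<le> T t"
  unfolding T_def by (rule member_le_sum) (auto intro: mult_nonneg_nonneg a_nonneg)

text \<open>Cauchy-Schwarz (\<open>c_sq\<close>) followed by the inequality of arithmetic and
  geometric means, with free weights \<open>x\<close> and \<open>y\<close>.\<close>

lemma cross_le: "2 * x * y * \<bar>c t i\<bar> \<le> x\<^sup>2 * a t i + y\<^sup>2 * b t i"
proof -
  have "(2 * x * y * \<bar>c t i\<bar>)\<^sup>2 = 4 * x\<^sup>2 * y\<^sup>2 * (c t i)\<^sup>2" by (simp add: power_mult_distrib)
  also have "\<dots> \<le> 4 * x\<^sup>2 * y\<^sup>2 * (a t i * b t i)" by (intro mult_left_mono c_sq) auto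
  also have "\<dots> \<le> (x\<^sup>2 * a t i + y\<^sup>2 * b t i)\<^sup>2"
    using zero_le_power2[of "x\<^sup>2 * a t i - y\<^sup>2 * b t i"] by (simp add: power2_eq_square algebra_simps)
  finally show ?thesis
    by (rule power2_le_imp_le) (intro add_nonneg_nonneg mult_nonneg_nonneg a_nonneg b_nonneg zero_le_power2)
qed

text \<open>The left side stands for the second moment of the difference of two consecutive
  positions, and (x - y)^2 is at most 2 (x^2 + y^2).\<close>

lemma b_Suc_le: "\<eta>\<^sup>2 * b (Suc t) i \<le> 2 * (a t i + a (Suc t) i)"
proof -
  have "\<eta>\<^sup>2 * b (Suc t) i = a t i - a (Suc t) i - 2 * \<eta> * c (Suc t) i"
    by (simp add: c_Suc a_Suc power2_eq_square algebra_simps)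
  moreover have "2 * 2 * \<eta> * \<bar>c (Suc t) i\<bar> \<le> 2\<^sup>2 * a (Suc t) i + \<eta>\<^sup>2 * b (Suc t) i" by (rule cross_le)
  moreover have "- (2 * \<eta> * c (Suc t) i) \<le> 2 * \<eta> * \<bar>c (Suc t) i\<bar>"
    using eta mult_left_mono[of "- c (Suc t) i" "\<bar>c (Suc t) i\<bar>" "2 * \<eta>"] by simp
  ultimately show ?thesis by simp
qed

text \<open>With e = 1 + \<beta> - \<eta> lam i, \<open>\<phi>\<close> is e times the second moment
  of (1 - \<beta>) position - \<eta> \<beta> momentum, plus nonnegative multiples of
  \<open>a\<close> and \<open>b\<close>.\<close>

lemma \<phi>_nonneg:
  assumes "\<eta> * lam i \<le> 1 + \<beta>"
  shows "0 \<le> \<phi> t i"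
proof -
  define e where "e = 1 + \<beta> - \<eta> * lam i"
  have e: "0 \<le> e" "e \<le> 1 + \<beta>" using assms eta lam[of i] by (auto simp: e_def)
  have "0 \<le> (\<eta> * \<beta>)\<^sup>2 * b t i" by (intro mult_nonneg_nonneg b_nonneg) auto
  then have b: "e * ((\<eta> * \<beta>)\<^sup>2 * b t i) \<le> (1 + \<beta>) * ((\<eta> * \<beta>)\<^sup>2 * b t i)"
    using e by (intro mult_right_mono) auto
  have a: "0 \<le> (1 - \<beta>) * (\<eta> * lam i * (1 + \<beta>)) * a t i"
    using beta eta lam a_nonneg by (intro mult_nonneg_nonneg) auto
  have "2 * (1 - \<beta>) * (\<eta> * \<beta>) * c t i \<le> 2 * (1 - \<beta>) * (\<eta> * \<beta>) * \<bar>c t i\<bar>"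
    using beta eta by (intro mult_left_mono) auto
  also have "\<dots> \<le> (1 - \<beta>)\<^sup>2 * a t i + (\<eta> * \<beta>)\<^sup>2 * b t i" by (rule cross_le)
  finally have "e * (2 * (1 - \<beta>) * (\<eta> * \<beta>) * c t i) \<le> e * ((1 - \<beta>)\<^sup>2 * a t i + (\<eta> * \<beta>)\<^sup>2 * b t i)"
    using e by (intro mult_left_mono) auto
  moreover have "\<phi> t i = e * ((1 - \<beta>)\<^sup>2 * a t i) + (1 - \<beta>) * (\<eta> * lam i * (1 + \<beta>)) * a t i
      + (1 + \<beta>) * ((\<eta> * \<beta>)\<^sup>2 * b t i) - e * (2 * (1 - \<beta>) * (\<eta> * \<beta>) * c t i)"
    unfolding \<phi>_def e_def by algebra
  ultimately show ?thesis using a b by (simp add: distrib_left)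
qed

text \<open>The weighted losses of all modes add up to T, while mode \<open>i\<close> gets back G i
  times T. The gain is thus the share of the common forcing that a mode returns, and the balance is
  decided by comparing the sum of the gains with 1.\<close>

lemma weighted_\<phi>_Suc:
  assumes "\<And>i. \<eta> * lam i < 1 + \<beta>"
  shows "(\<Sum>i\<in>UNIV. w i * \<phi> (Suc t) i) = (\<Sum>i\<in>UNIV. w i * \<phi> t i) - (1 - (\<Sum>i\<in>UNIV. G i)) * T t"
proof -
  have "w i * \<phi> (Suc t) i = w i * \<phi> t i - (lam i)\<^sup>2 * a t i + G i * T t" for i
  proof -
    have pos: "1 + \<beta> - \<eta> * lam i \<noteq> 0" "1 - \<beta> \<noteq> 0" "\<eta> \<noteq> 0" "1 + \<beta> \<noteq> 0"
      using assms[of i] beta eta by auto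
    have 1: "w i * (2 * \<eta> * (1 - \<beta>)\<^sup>2 * (1 + \<beta> - \<eta> * lam i)) = lam i"
      using pos by (simp add: w_def)
    have "G i = \<eta> * lam i * (1 + \<beta>) / (2 * (1 + \<beta> - \<eta> * lam i))"
      using pos by (simp add: gain_def divide_simps)
    also have "\<dots> = w i * (\<eta>\<^sup>2 * (1 - \<beta>)\<^sup>2 * (1 + \<beta>))"
      using pos by (simp add: w_def power2_eq_square)
    finally have 2: "w i * (\<eta>\<^sup>2 * (1 - \<beta>)\<^sup>2 * (1 + \<beta>)) = G i" by simp
    have "w i * \<phi> (Suc t) i = w i * \<phi> t i - (w i * (2 * \<eta> * (1 - \<beta>)\<^sup>2 * (1 + \<beta> - \<eta> * lam i))) * (lam i * a t i)
        + (w i * (\<eta>\<^sup>2 * (1 - \<beta>)\<^sup>2 * (1 + \<beta>))) * T t"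
      unfolding \<phi>_Suc by (simp add: algebra_simps)
    then show ?thesis unfolding 1 2 by (simp add: power2_eq_square)
  qed
  then have "(\<Sum>i\<in>UNIV. w i * \<phi> (Suc t) i)
      = (\<Sum>i\<in>UNIV. w i * \<phi> t i) - T t + (\<Sum>i\<in>UNIV. G i) * T t"
    by (simp add: sum.distrib sum_subtractf sum_distrib_right T_def)
  then show ?thesis by (simp add: algebra_simps)
qed

lemma bounded:
  assumes small: "\<And>i. \<eta> * lam i < 1 + \<beta>" and G1: "(\<Sum>i\<in>UNIV. G i) < 1"
  shows "\<exists>B. \<forall>t. a t i \<le> B"
proof -
  define \<Phi> where "\<Phi> t = (\<Sum>i\<in>UNIV. w i * \<phi> t i)" for t
  define \<gamma> where "\<gamma> = 1 - (\<Sum>i\<in>UNIV. G i)"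
  have \<gamma>: "\<gamma> > 0" using G1 by (simp add: \<gamma>_def)
  have \<Phi>_Suc: "\<Phi> (Suc t) = \<Phi> t - \<gamma> * T t" for t
    unfolding \<Phi>_def \<gamma>_def by (rule weighted_\<phi>_Suc[OF small])
  have \<Phi>_nonneg: "0 \<le> \<Phi> t" for t
    unfolding \<Phi>_def w_def
    using beta eta lam small \<phi>_nonneg less_imp_le[OF small]
    by (intro sum_nonneg mult_nonneg_nonneg divide_nonneg_nonneg) (auto simp: less_imp_le)
  have \<Phi>_le: "\<Phi> t \<le> \<Phi> 0" for t
  proof (induction t)
    case (Suc t)
    have "\<gamma> * T t \<ge> 0" using \<gamma> T_nonneg by simp
    then show ?case using Suc \<Phi>_Suc[of t] by simp
  qed simp
  have T_le: "T t \<le> \<Phi> 0 / \<gamma>" for t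
    using \<Phi>_Suc[of t] \<Phi>_nonneg[of "Suc t"] \<Phi>_le[of t] \<gamma> by (simp add: field_simps)
  show ?thesis
  proof (cases "lam i = 0")
    case False
    have "a t i \<le> \<Phi> 0 / \<gamma> / (lam i)\<^sup>2" for t
    proof -
      have "a t i * (lam i)\<^sup>2 \<le> \<Phi> 0 / \<gamma>"
        using lam_sq_le_T[of i t] T_le[of t] by (simp only: mult.commute)
      then show ?thesis using False by (subst pos_le_divide_eq) auto
    qed
    then show ?thesis by blast
  next
    \<comment> \<open>A null mode does not enter T, so the bound on T says nothing about its
      position. The forcing T bounds its momentum, and \<open>\<phi>\<close> then bounds a
      combination of position and momentum.\<close>
    case True
    have b_le: "b t i \<le> (1 - \<beta>) * (\<Phi> 0 / \<gamma>)" for t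
    proof (induction t)
      case 0
      show ?case using beta \<gamma> \<Phi>_nonneg[of 0] by (simp add: b_0)
    next
      case (Suc t)
      have "b (Suc t) i = \<beta>\<^sup>2 * b t i + (1 - \<beta>)\<^sup>2 * T t" using b_Suc[of t i] True by (simp add: T_def)
      also have "\<dots> \<le> \<beta>\<^sup>2 * ((1 - \<beta>) * (\<Phi> 0 / \<gamma>)) + (1 - \<beta>)\<^sup>2 * (\<Phi> 0 / \<gamma>)"
        using Suc T_le by (intro add_mono mult_left_mono) auto
      also have "\<dots> = (1 - \<beta> * (1 - \<beta>)) * ((1 - \<beta>) * (\<Phi> 0 / \<gamma>))" by algebra
      also have "\<dots> \<le> 1 * ((1 - \<beta>) * (\<Phi> 0 / \<gamma>))"
        using beta \<gamma> \<Phi>_nonneg[of 0] by (intro mult_right_mono) auto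
      finally show ?case by simp
    qed
    \<comment> \<open>For eigenvalue 0, \<open>\<phi>\<close> only gains, by K \<gamma> T per step,
      while \<Phi> loses \<gamma> T; hence \<open>\<phi>\<close> + K \<Phi> is conserved.\<close>
    define K where "K = \<eta>\<^sup>2 * (1 - \<beta>)\<^sup>2 * (1 + \<beta>) / \<gamma>"
    have K: "K \<ge> 0" "K * \<gamma> = \<eta>\<^sup>2 * (1 - \<beta>)\<^sup>2 * (1 + \<beta>)" using beta \<gamma> by (auto simp: K_def)
    have "\<phi> (Suc t) i + K * \<Phi> (Suc t) = \<phi> t i + K * \<Phi> t" for t
    proof -
      have "\<phi> (Suc t) i = \<phi> t i + K * \<gamma> * T t" using \<phi>_Suc[of t i] True by (simp add: K)
      then show ?thesis by (simp add: \<Phi>_Suc algebra_simps)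
    qed
    then have conserved: "\<phi> t i + K * \<Phi> t = \<phi> 0 i + K * \<Phi> 0" for t by (induction t) auto
    have \<phi>_le: "\<phi> t i \<le> \<phi> 0 i + K * \<Phi> 0" for t
      using conserved[of t] mult_nonneg_nonneg[OF K(1) \<Phi>_nonneg[of t]] by simp
    define B where "B = 2 * (\<phi> 0 i + K * \<Phi> 0) / (1 + \<beta>) + 2 * (\<eta> * \<beta>)\<^sup>2 * ((1 - \<beta>) * (\<Phi> 0 / \<gamma>))"
    have "a t i \<le> B / (1 - \<beta>)\<^sup>2" for t
    proof -
      \<comment> \<open>This encodes x^2 <= 2 (x - y)^2 + 2 y^2 with x = (1 - \<beta>) position and
        y = \<eta> \<beta> momentum; for eigenvalue 0 the second moment of x - y is
        \<open>\<phi>\<close> / (1 + \<beta>).\<close>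
      have "2 * (1 - \<beta>) * (2 * (\<eta> * \<beta>)) * c t i \<le> 2 * (1 - \<beta>) * (2 * (\<eta> * \<beta>)) * \<bar>c t i\<bar>"
        using beta eta by (intro mult_left_mono) auto
      also have "\<dots> \<le> (1 - \<beta>)\<^sup>2 * a t i + (2 * (\<eta> * \<beta>))\<^sup>2 * b t i" by (rule cross_le)
      finally have "(1 - \<beta>)\<^sup>2 * a t i \<le>
          2 * ((1 - \<beta>)\<^sup>2 * a t i + (\<eta> * \<beta>)\<^sup>2 * b t i - 2 * (1 - \<beta>) * (\<eta> * \<beta>) * c t i) + 2 * ((\<eta> * \<beta>)\<^sup>2 * b t i)"
        by (simp add: power_mult_distrib algebra_simps)
      also have "(1 - \<beta>)\<^sup>2 * a t i + (\<eta> * \<beta>)\<^sup>2 * b t i - 2 * (1 - \<beta>) * (\<eta> * \<beta>) * c t i = \<phi> t i / (1 + \<beta>)"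
        using beta True by (simp add: \<phi>_def field_simps power2_eq_square)
      also have "2 * (\<phi> t i / (1 + \<beta>)) + 2 * ((\<eta> * \<beta>)\<^sup>2 * b t i)
          \<le> 2 * ((\<phi> 0 i + K * \<Phi> 0) / (1 + \<beta>)) + 2 * ((\<eta> * \<beta>)\<^sup>2 * ((1 - \<beta>) * (\<Phi> 0 / \<gamma>)))"
        using beta \<phi>_le[of t] b_le[of t] by (intro add_mono mult_left_mono divide_right_mono) auto
      finally show ?thesis
        using beta by (simp add: B_def pos_le_divide_eq mult.commute mult.left_commute)
    qed
    then show ?thesis by blast
  qed
qed

text \<open>The functional never falls below its positive initial value and is at most K (T t + T
  (t+1)) at time t+1. So T cannot be small at two consecutive times, the functional gains a fixed
  amount every two steps, and bounded positions would keep it bounded. Null modes need weight 0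
  because T does not see them.\<close>

lemma growing_functional_unbounded:
  assumes v: "\<And>i. 0 \<le> v i" "\<And>i. lam i = 0 \<Longrightarrow> v i = 0"
    and \<delta>: "0 < \<delta>"
    and grow: "\<And>t. (\<Sum>i\<in>UNIV. v i * \<phi> (Suc t) i) \<ge> (\<Sum>i\<in>UNIV. v i * \<phi> t i) + \<delta> * T t"
    and init: "0 < (\<Sum>i\<in>UNIV. v i * \<phi> 0 i)"
  shows "\<not> (\<forall>t i. a t i \<le> B)"
proof
  assume B: "\<forall>t i. a t i \<le> B"
  define \<Phi> where "\<Phi> t = (\<Sum>i\<in>UNIV. v i * \<phi> t i)" for t
  have \<Phi>_ge: "\<Phi> (Suc t) \<ge> \<Phi> t + \<delta> * T t" for t unfolding \<Phi>_def by (rule grow)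
  have T\<delta>: "\<delta> * T t \<ge> 0" for t using \<delta> T_nonneg by simp
  have \<Phi>0: "\<Phi> t \<ge> \<Phi> 0" for t
  proof (induction t)
    case (Suc t)
    then show ?case using \<Phi>_ge[of t] T\<delta>[of t] by simp
  qed simp
  \<comment> \<open>Two times appear because \<open>b_Suc_le\<close> controls the new momentum by
    the old and the new position. \<open>cross_le\<close> handles the mixed moment, and division by
    (lam i)^2 passes from positions to T.\<close>
  have "\<exists>C\<ge>0. \<forall>t. v i * \<phi> (Suc t) i \<le> C * (T t + T (Suc t))" for i
  proof (cases "lam i = 0")
    case True
    then show ?thesis using v(2) by (intro exI[of _ 0]) auto
  next
    case False
    define p where "p = (1 - \<beta>) * ((1 - \<beta>) * (1 + \<beta>) + 2 * \<beta> * \<eta> * lam i)"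
    define q where "q = \<eta>\<^sup>2 * \<beta>\<^sup>2 * (1 + \<beta>)"
    define r where "r = \<bar>2 * \<eta> * \<beta> * (1 - \<beta>) * (1 + \<beta> - \<eta> * lam i)\<bar>"
    have p: "p \<ge> 0" using beta eta lam[of i] by (simp add: p_def)
    have q: "q \<ge> 0" using beta by (simp add: q_def)
    have r: "r \<ge> 0" by (simp add: r_def)
    define D where "D = p + r + (q + r) * (2 / \<eta>\<^sup>2)"
    have D: "D \<ge> 0" using p q r by (simp add: D_def)
    have "v i * \<phi> (Suc t) i \<le> v i * D / (lam i)\<^sup>2 * (T t + T (Suc t))" for t
    proof -
      have c: "\<bar>c (Suc t) i\<bar> \<le> a (Suc t) i + b (Suc t) i"
        using cross_le[of 1 1 "Suc t" i] by simp
      have b: "b (Suc t) i \<le> 2 / \<eta>\<^sup>2 * (a t i + a (Suc t) i)"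
        using b_Suc_le[of t i] eta by (simp add: field_simps)
      have "\<phi> (Suc t) i = p * a (Suc t) i + q * b (Suc t) i - 2 * \<eta> * \<beta> * (1 - \<beta>) * (1 + \<beta> - \<eta> * lam i) * c (Suc t) i"
        by (simp add: \<phi>_def p_def q_def)
      also have "\<dots> \<le> p * a (Suc t) i + q * b (Suc t) i + r * \<bar>c (Suc t) i\<bar>"
        using abs_ge_minus_self[of "2 * \<eta> * \<beta> * (1 - \<beta>) * (1 + \<beta> - \<eta> * lam i) * c (Suc t) i"]
        unfolding r_def abs_mult[symmetric] by simp
      also have "\<dots> \<le> p * a (Suc t) i + q * b (Suc t) i + r * (a (Suc t) i + b (Suc t) i)"
        using c r by (intro add_left_mono mult_left_mono) auto
      also have "\<dots> = (p + r) * a (Suc t) i + (q + r) * b (Suc t) i" by (simp add: algebra_simps)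
      also have "\<dots> \<le> (p + r) * (a t i + a (Suc t) i) + (q + r) * (2 / \<eta>\<^sup>2 * (a t i + a (Suc t) i))"
        using p q r b a_nonneg[of t i] by (intro add_mono mult_left_mono) auto
      also have "\<dots> = D * (a t i + a (Suc t) i)" by (simp add: D_def algebra_simps)
      also have "\<dots> \<le> D * ((T t + T (Suc t)) / (lam i)\<^sup>2)"
        using lam_sq_le_T[of i t] lam_sq_le_T[of i "Suc t"] False D
        by (intro mult_left_mono) (auto simp: pos_le_divide_eq algebra_simps)
      finally have "v i * \<phi> (Suc t) i \<le> v i * (D * ((T t + T (Suc t)) / (lam i)\<^sup>2))"
        using v(1) by (intro mult_left_mono) auto
      then show ?thesis by simp
    qed
    then show ?thesis using v(1) D by (intro exI[of _ "v i * D / (lam i)\<^sup>2"]) simp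
  qed
  then obtain C where C: "\<And>i. C i \<ge> 0" "\<And>i t. v i * \<phi> (Suc t) i \<le> C i * (T t + T (Suc t))" by metis
  define K where "K = (\<Sum>i\<in>UNIV. C i) + 1"
  have K: "K > 0" using C(1) by (simp add: K_def add_nonneg_pos sum_nonneg)
  have \<Phi>_le: "\<Phi> (Suc t) \<le> K * (T t + T (Suc t))" for t
  proof -
    have "\<Phi> (Suc t) \<le> (\<Sum>i\<in>UNIV. C i * (T t + T (Suc t)))"
      unfolding \<Phi>_def by (intro sum_mono C)
    also have "\<dots> \<le> K * (T t + T (Suc t))"
      unfolding K_def sum_distrib_right[symmetric]
      using T_nonneg[of t] T_nonneg[of "Suc t"] by (intro mult_right_mono) auto
    finally show ?thesis .
  qed
  \<comment> \<open>The gain over two steps is \<delta> (T t + T (t+1)), at least \<delta> / K times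
    the functional at time t+1, which is no smaller than its initial value.\<close>
  define \<epsilon> where "\<epsilon> = \<delta> / K * \<Phi> 0"
  have \<epsilon>: "\<epsilon> > 0" using \<delta> K init by (simp add: \<epsilon>_def \<Phi>_def)
  have step: "\<Phi> (Suc (Suc t)) \<ge> \<Phi> t + \<epsilon>" for t
  proof -
    have "\<epsilon> \<le> \<delta> / K * \<Phi> (Suc t)" unfolding \<epsilon>_def using \<Phi>0 \<delta> K by (intro mult_left_mono) auto
    also have "\<dots> \<le> \<delta> / K * (K * (T t + T (Suc t)))" using \<Phi>_le \<delta> K by (intro mult_left_mono) auto
    also have "\<dots> = \<delta> * T t + \<delta> * T (Suc t)" using K by (simp add: algebra_simps)
    finally show ?thesis using \<Phi>_ge[of t] \<Phi>_ge[of "Suc t"] by linarith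
  qed
  have lin: "\<Phi> (2 * n) \<ge> real n * \<epsilon>" for n
  proof (induction n)
    case 0
    show ?case using init by (simp add: \<Phi>_def)
  next
    case (Suc n)
    then show ?case using step[of "2 * n"] by (simp add: algebra_simps)
  qed
  have T_le: "T t \<le> (\<Sum>j\<in>UNIV. (lam j)\<^sup>2 * B)" for t
    unfolding T_def using B by (intro sum_mono mult_left_mono) auto
  define U where "U = K * (2 * (\<Sum>j\<in>UNIV. (lam j)\<^sup>2 * B))"
  have "\<Phi> (Suc t) \<le> U" for t
  proof -
    have "K * (T t + T (Suc t)) \<le> U"
      unfolding U_def using T_le[of t] T_le[of "Suc t"] K by (intro mult_left_mono) auto
    then show ?thesis using \<Phi>_le[of t] by simp
  qed
  then have U: "\<Phi> (2 * Suc n) \<le> U" for n by simp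
  obtain n where "U < real n * \<epsilon>" using reals_Archimedean3[OF \<epsilon>] by blast
  then have "U < real (Suc n) * \<epsilon>" using \<epsilon> by (simp add: algebra_simps)
  then show False using lin[of "Suc n"] U[of n] by linarith
qed

text \<open>Zero initial momentum also kills the mixed moment, by \<open>c_sq\<close>.\<close>

lemma \<phi>_0: "\<phi> 0 i = (1 - \<beta>) * ((1 - \<beta>) * (1 + \<beta>) + 2 * \<beta> * \<eta> * lam i) * a 0 i"
  using c_sq[of 0 i] by (simp add: \<phi>_def b_0)

lemma \<phi>_0_pos: "0 < a 0 i \<Longrightarrow> 0 < \<phi> 0 i"
  unfolding \<phi>_0 using beta eta lam[of i] by (intro mult_pos_pos add_pos_nonneg) auto

lemma \<phi>_0_nonneg: "0 \<le> \<phi> 0 i"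
  unfolding \<phi>_0 using beta eta lam[of i] a_nonneg[of 0 i] by (intro mult_nonneg_nonneg add_nonneg_nonneg) auto

text \<open>From the threshold on, the loss term in \<open>\<phi>_Suc\<close> no longer has the sign
  of a loss, so \<open>\<phi>\<close> of the single mode \<open>k\<close> grows with the forcing.
  The weights \<open>w\<close> would have a vanishing or negative denominator here.\<close>

lemma unbounded_large_eigenvalue:
  assumes "1 + \<beta> \<le> \<eta> * lam k" "0 < a 0 k"
  shows "\<not> (\<forall>t i. a t i \<le> B)"
proof (rule growing_functional_unbounded[where v = "\<lambda>i. if i = k then 1 else 0" and \<delta> = "\<eta>\<^sup>2 * (1 - \<beta>)\<^sup>2 * (1 + \<beta>)"])
  show "(if i = k then 1 else 0) = (0::real)" if "lam i = 0" for i
    using that assms beta by auto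
  show "0 < \<eta>\<^sup>2 * (1 - \<beta>)\<^sup>2 * (1 + \<beta>)" using beta eta by simp
  have sing: "(\<Sum>i\<in>UNIV. (if i = k then 1 else 0) * \<phi> t i) = \<phi> t k" for t
    by (simp add: if_distrib if_distribR cong: if_cong)
  show "0 < (\<Sum>i\<in>UNIV. (if i = k then 1 else 0) * \<phi> 0 i)"
    unfolding sing using assms(2) by (rule \<phi>_0_pos)
  fix t
  have "0 \<le> 2 * \<eta> * (1 - \<beta>)\<^sup>2 * (\<eta> * lam k - (1 + \<beta>)) * lam k * a t k"
    using beta eta lam[of k] a_nonneg[of t k] assms(1) by (intro mult_nonneg_nonneg) auto
  then show "(\<Sum>i\<in>UNIV. (if i = k then 1 else 0) * \<phi> t i) + \<eta>\<^sup>2 * (1 - \<beta>)\<^sup>2 * (1 + \<beta>) * T t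
      \<le> (\<Sum>i\<in>UNIV. (if i = k then 1 else 0) * \<phi> (Suc t) i)"
    unfolding sing \<phi>_Suc[of t k] by (simp add: algebra_simps)
qed auto

lemma unbounded_large_sum:
  assumes small: "\<And>i. \<eta> * lam i < 1 + \<beta>" and G1: "(\<Sum>i\<in>UNIV. G i) > 1"
    and k: "0 < lam k" "0 < a 0 k"
  shows "\<not> (\<forall>t i. a t i \<le> B)"
proof (rule growing_functional_unbounded[where v = w and \<delta> = "(\<Sum>i\<in>UNIV. G i) - 1"])
  show w: "0 \<le> w i" for i
    unfolding w_def using small[of i] beta eta lam[of i] by (intro divide_nonneg_nonneg mult_nonneg_nonneg) auto
  show "w i = 0" if "lam i = 0" for i using that by (simp add: w_def)
  show "(\<Sum>i\<in>UNIV. w i * \<phi> t i) + ((\<Sum>i\<in>UNIV. G i) - 1) * T t \<le> (\<Sum>i\<in>UNIV. w i * \<phi> (Suc t) i)" for t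
    unfolding weighted_\<phi>_Suc[OF small] by (simp add: algebra_simps)
  have "0 < w k" unfolding w_def using small[of k] beta eta k by (intro divide_pos_pos mult_pos_pos) auto
  then have "0 < w k * \<phi> 0 k" using \<phi>_0_pos[OF k(2)] by simp
  also have "\<dots> \<le> (\<Sum>i\<in>UNIV. w i * \<phi> 0 i)"
    by (rule member_le_sum) (auto intro: mult_nonneg_nonneg w \<phi>_0_nonneg)
  finally show "0 < (\<Sum>i\<in>UNIV. w i * \<phi> 0 i)" .
qed (use G1 in auto)

end

subsection \<open>Moments of the random directions weighted by the past\<close>

lemma depends_on_inner2:
  fixes X Y :: "_ \<Rightarrow> real^'n"
  shows "depends_on K X \<Longrightarrow> depends_on K Y \<Longrightarrow> depends_on K (\<lambda>\<omega>. X \<omega> \<bullet> Y \<omega>)"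
  by (drule (1) depends_on_continuous2[where h = "\<lambda>(x, y). x \<bullet> y"])
    (auto simp: case_prod_unfold intro!: continuous_intros)

lemma depends_on_vecI:
  fixes X :: "_ \<Rightarrow> real^'n"
  assumes "\<And>a. depends_on K (\<lambda>\<omega>. X \<omega> \<bullet> a)"
  shows "depends_on K X"
proof (rule depends_onI)
  show "X \<in> borel_measurable gauss_space"
    using assms by (subst borel_measurable_euclidean_space) (auto dest: depends_on_measurable)
  show "X \<omega> = X \<omega>'" if "\<And>i. i \<in> K \<Longrightarrow> \<omega> i = \<omega>' i" for \<omega> \<omega>'
  proof (rule euclidean_eqI)
    fix b :: "real^'n"
    show "X \<omega> \<bullet> b = X \<omega>' \<bullet> b"
      using assms[of b] that unfolding depends_on_def by (metis (mono_tags))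
  qed
qed

lemma matrix_vector_inner: "(B *v x) \<bullet> a = x \<bullet> (transpose B *v a)" for B :: "real^'n^'n"
  by (metis dot_lmul_matrix inner_commute transpose_matrix_vector)

lemma depends_on_matrix_vector:
  fixes X :: "_ \<Rightarrow> real^'n" and B :: "real^'n^'n"
  assumes "depends_on K X"
  shows "depends_on K (\<lambda>\<omega>. B *v X \<omega>)"
  by (rule depends_on_vecI) (simp only: matrix_vector_inner depends_on_inner[OF assms])

lemma depends_on_gdir_vec: "depends_on ({t} \<times> UNIV) (\<lambda>\<omega>. gdir \<omega> t)"
  by (rule depends_on_vecI) (rule depends_on_gdir)

section \<open>Square integrability and conditional moments of the gradient noise\<close>

definition square_int :: "(((nat \<times> 'n::finite) \<Rightarrow> real) \<Rightarrow> real) \<Rightarrow> bool" where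
  "square_int X \<longleftrightarrow> X \<in> borel_measurable gauss_space \<and> integrable gauss_space (\<lambda>\<omega>. (X \<omega>)\<^sup>2)"

lemma square_int_const [simp]: "square_int (\<lambda>_. c)"
  by (simp add: square_int_def)

lemma square_int_mult_integrable:
  assumes "square_int X" "square_int Y"
  shows "integrable gauss_space (\<lambda>\<omega>. X \<omega> * Y \<omega>)"
proof (rule Bochner_Integration.integrable_bound)
  show "integrable gauss_space (\<lambda>\<omega>. (X \<omega>)\<^sup>2 + (Y \<omega>)\<^sup>2)"
    using assms by (simp add: square_int_def)
  show "(\<lambda>\<omega>. X \<omega> * Y \<omega>) \<in> borel_measurable gauss_space"
    using assms by (auto simp: square_int_def)
  have "\<bar>x * y\<bar> \<le> \<bar>x\<^sup>2 + y\<^sup>2\<bar>" for x y :: real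
  proof -
    have "2 * (\<bar>x\<bar> * \<bar>y\<bar>) \<le> x\<^sup>2 + y\<^sup>2"
      using sum_squares_bound[of "\<bar>x\<bar>" "\<bar>y\<bar>"] by (simp add: mult.assoc)
    moreover have "0 \<le> \<bar>x\<bar> * \<bar>y\<bar>" by simp
    ultimately have "\<bar>x\<bar> * \<bar>y\<bar> \<le> x\<^sup>2 + y\<^sup>2" by linarith
    then show ?thesis by (simp add: abs_mult)
  qed
  then show "AE \<omega> in gauss_space. norm (X \<omega> * Y \<omega>) \<le> norm ((X \<omega>)\<^sup>2 + (Y \<omega>)\<^sup>2)" by simp
qed

lemma square_int_integrable: "square_int X \<Longrightarrow> integrable gauss_space X"
  using square_int_mult_integrable[of X "\<lambda>_. 1"] by simp

lemma square_int_cmult: "square_int X \<Longrightarrow> square_int (\<lambda>\<omega>. c * X \<omega>)"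
  by (auto simp: square_int_def power_mult_distrib)

lemma square_int_add:
  assumes "square_int X" "square_int Y"
  shows "square_int (\<lambda>\<omega>. X \<omega> + Y \<omega>)"
proof -
  have "integrable gauss_space (\<lambda>\<omega>. (X \<omega>)\<^sup>2 + (Y \<omega>)\<^sup>2 + 2 * (X \<omega> * Y \<omega>))"
    using assms square_int_mult_integrable[OF assms] by (simp add: square_int_def)
  then show ?thesis using assms by (auto simp: square_int_def power2_sum mult.assoc)
qed

lemma square_int_sum:
  assumes "\<And>i. i \<in> I \<Longrightarrow> square_int (X i)"
  shows "square_int (\<lambda>\<omega>. \<Sum>i\<in>I. X i \<omega>)"
  using assms by (induction I rule: infinite_finite_induct) (auto intro: square_int_add)

lemma expectation_product_le:
  assumes "square_int X" "square_int Y"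
  shows "(\<integral>\<omega>. X \<omega> * Y \<omega> \<partial>gauss_space)\<^sup>2 \<le> (\<integral>\<omega>. (X \<omega>)\<^sup>2 \<partial>gauss_space) * (\<integral>\<omega>. (Y \<omega>)\<^sup>2 \<partial>gauss_space)"
proof -
  define x where "x = (\<integral>\<omega>. (X \<omega>)\<^sup>2 \<partial>gauss_space)"
  define y where "y = (\<integral>\<omega>. (Y \<omega>)\<^sup>2 \<partial>gauss_space)"
  define z where "z = (\<integral>\<omega>. X \<omega> * Y \<omega> \<partial>gauss_space)"
  have nonneg: "0 \<le> x" "0 \<le> y" by (simp_all add: x_def y_def)
  have q: "0 \<le> s\<^sup>2 * x + t\<^sup>2 * y + 2 * s * t * z" for s t
  proof -
    have "s\<^sup>2 * x + t\<^sup>2 * y + 2 * s * t * z = (\<integral>\<omega>. s\<^sup>2 * (X \<omega>)\<^sup>2 + t\<^sup>2 * (Y \<omega>)\<^sup>2 + 2 * s * t * (X \<omega> * Y \<omega>) \<partial>gauss_space)"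
      using assms square_int_mult_integrable[OF assms] by (simp add: square_int_def x_def y_def z_def)
    also have "\<dots> = (\<integral>\<omega>. (s * X \<omega> + t * Y \<omega>)\<^sup>2 \<partial>gauss_space)"
      by (intro Bochner_Integration.integral_cong) (auto simp: power2_eq_square algebra_simps)
    also have "\<dots> \<ge> 0" by simp
    finally show ?thesis .
  qed
  have "z\<^sup>2 \<le> x * y"
  proof (cases "y = 0")
    case True
    have "z = 0"
    proof (rule ccontr)
      assume "z \<noteq> 0"
      \<comment> \<open>At these arguments the quadratic form equals x - (x + 1) = -1.\<close>
      then show False using q[of 1 "- (x + 1) / (2 * z)"] True by (simp add: field_simps)
    qed
    then show ?thesis using True by simp
  next
    case False
    have "0 \<le> y * (x * y - z\<^sup>2)" using q[of y "- z"] by (simp add: power2_eq_square algebra_simps)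
    then show ?thesis using False nonneg by (simp add: zero_le_mult_iff)
  qed
  then show ?thesis by (simp add: x_def y_def z_def)
qed

lemma gdir_independent:
  fixes X U :: "((nat \<times> 'n::finite) \<Rightarrow> real) \<Rightarrow> real"
  assumes "depends_on ({..<t} \<times> UNIV) X" "integrable gauss_space X"
    and "depends_on ({t} \<times> UNIV) U" "has_bochner_integral gauss_space U u"
  shows "has_bochner_integral gauss_space (\<lambda>\<omega>. U \<omega> * X \<omega>) (u * (\<integral>\<omega>. X \<omega> \<partial>gauss_space))"
  by (rule has_bochner_integral_mult_depends_on[OF assms(3,1) _ assms(4)])
    (use assms(2) in \<open>auto simp: has_bochner_integral_iff\<close>)

context
  fixes W :: "((nat \<times> 'n::finite) \<Rightarrow> real) \<Rightarrow> real^'n" and t :: nat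
  assumes W_past: "depends_on ({..<t} \<times> UNIV) W" and W_sq: "\<And>a. square_int (\<lambda>\<omega>. W \<omega> \<bullet> a)"
begin

text \<open>Expanding u . W in coordinates separates the fresh direction from the past in every
  summand, so independence reduces the claim to fourth moments of the direction and second moments
  of \<open>W\<close>. The next two lemmas use the same device.\<close>

lemma gdir_noise_square_int: "square_int (\<lambda>\<omega>. (gdir \<omega> t \<bullet> W \<omega>) * (gdir \<omega> t \<bullet> b))"
proof -
  have "square_int (\<lambda>\<omega>. \<Sum>k\<in>Basis. (gdir \<omega> t \<bullet> k) * (gdir \<omega> t \<bullet> b) * (W \<omega> \<bullet> k))"
  proof (rule square_int_sum)
    fix k :: "real^'n"
    have "has_bochner_integral gauss_space
       (\<lambda>\<omega>. (gdir \<omega> t \<bullet> k) * (gdir \<omega> t \<bullet> k) * (gdir \<omega> t \<bullet> b)\<^sup>2 * (W \<omega> \<bullet> k)\<^sup>2)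
       (((k \<bullet> k) * (b \<bullet> b) + 2 * (k \<bullet> b) * (k \<bullet> b)) * (\<integral>\<omega>. (W \<omega> \<bullet> k)\<^sup>2 \<partial>gauss_space))"
      using W_sq[of k]
      by (intro gdir_independent[where t = t] depends_on_power depends_on_mult depends_on_gdir gdir_mixed_fourth_moment
          depends_on_inner W_past) (auto simp: square_int_def)
    then have "integrable gauss_space (\<lambda>\<omega>. ((gdir \<omega> t \<bullet> k) * (gdir \<omega> t \<bullet> b) * (W \<omega> \<bullet> k))\<^sup>2)"
      by (simp add: has_bochner_integral_iff power_mult_distrib power2_eq_square[of "gdir _ _ \<bullet> k"])
    moreover have "(\<lambda>\<omega>. (gdir \<omega> t \<bullet> k) * (gdir \<omega> t \<bullet> b) * (W \<omega> \<bullet> k)) \<in> borel_measurable gauss_space"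
      using depends_on_measurable[OF depends_on_gdir[of t k]] depends_on_measurable[OF depends_on_gdir[of t b]]
        W_sq[of k] by (auto simp: square_int_def intro!: borel_measurable_times)
    ultimately show "square_int (\<lambda>\<omega>. (gdir \<omega> t \<bullet> k) * (gdir \<omega> t \<bullet> b) * (W \<omega> \<bullet> k))"
      by (simp add: square_int_def)
  qed
  then show ?thesis
    by (simp add: euclidean_inner[of "gdir _ t" "W _"] sum_distrib_right mult.assoc mult.commute[of "W _ \<bullet> _"])
qed

text \<open>Given the past, u u^T has expectation I. The test variable \<open>X\<close> serves to
  compute the moments of the noise against earlier position and momentum; with X = 1 it gives the
  mean.\<close>

lemma gdir_noise_mean:
  assumes X: "depends_on ({..<t} \<times> UNIV) X" "square_int X"
  shows "has_bochner_integral gauss_space (\<lambda>\<omega>. (gdir \<omega> t \<bullet> W \<omega>) * (gdir \<omega> t \<bullet> b) * X \<omega>)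
    (\<integral>\<omega>. (W \<omega> \<bullet> b) * X \<omega> \<partial>gauss_space)"
proof -
  have int: "integrable gauss_space (\<lambda>\<omega>. (W \<omega> \<bullet> k) * X \<omega>)" for k
    by (rule square_int_mult_integrable[OF W_sq X(2)])
  have "has_bochner_integral gauss_space
      (\<lambda>\<omega>. \<Sum>k\<in>Basis. (gdir \<omega> t \<bullet> k) * (gdir \<omega> t \<bullet> b) * ((W \<omega> \<bullet> k) * X \<omega>))
      (\<Sum>k\<in>Basis. (k \<bullet> b) * (\<integral>\<omega>. (W \<omega> \<bullet> k) * X \<omega> \<partial>gauss_space))"
    by (intro has_bochner_integral_sum gdir_independent[where t = t] int depends_on_mult depends_on_gdir
        gdir_covariance depends_on_inner W_past X)
  also have "(\<Sum>k\<in>Basis. (k \<bullet> b) * (\<integral>\<omega>. (W \<omega> \<bullet> k) * X \<omega> \<partial>gauss_space))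
      = (\<integral>\<omega>. (\<Sum>k\<in>Basis. (k \<bullet> b) * ((W \<omega> \<bullet> k) * X \<omega>)) \<partial>gauss_space)"
    using int by simp
  also have "(\<lambda>\<omega>. \<Sum>k\<in>Basis. (k \<bullet> b) * ((W \<omega> \<bullet> k) * X \<omega>)) = (\<lambda>\<omega>. (W \<omega> \<bullet> b) * X \<omega>)"
    by (rule ext) (simp add: euclidean_inner[of "W _" b] sum_distrib_right inner_commute[of b] mult.assoc mult.left_commute)
  also have "(\<lambda>\<omega>. \<Sum>k\<in>Basis. (gdir \<omega> t \<bullet> k) * (gdir \<omega> t \<bullet> b) * ((W \<omega> \<bullet> k) * X \<omega>))
      = (\<lambda>\<omega>. (gdir \<omega> t \<bullet> W \<omega>) * (gdir \<omega> t \<bullet> b) * X \<omega>)"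
    by (rule ext) (simp add: euclidean_inner[of "gdir _ t" "W _"] sum_distrib_right mult.assoc mult.left_commute)
  finally show ?thesis .
qed

text \<open>Given the past, this is the fourth-moment formula applied to \<open>W\<close> and
  \<open>b\<close>. Its isotropic first term is the sole source of coupling between the
  modes.\<close>

lemma gdir_noise_second_moment:
  "has_bochner_integral gauss_space (\<lambda>\<omega>. ((gdir \<omega> t \<bullet> W \<omega>) * (gdir \<omega> t \<bullet> b))\<^sup>2)
    (\<integral>\<omega>. (W \<omega> \<bullet> W \<omega>) * (b \<bullet> b) + 2 * (W \<omega> \<bullet> b)\<^sup>2 \<partial>gauss_space)"
proof -
  have int: "integrable gauss_space (\<lambda>\<omega>. (W \<omega> \<bullet> k) * (W \<omega> \<bullet> l))" for k l
    by (rule square_int_mult_integrable[OF W_sq W_sq])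
  have "has_bochner_integral gauss_space
      (\<lambda>\<omega>. \<Sum>k\<in>Basis. \<Sum>l\<in>Basis. (gdir \<omega> t \<bullet> k) * (gdir \<omega> t \<bullet> l) * (gdir \<omega> t \<bullet> b)\<^sup>2 * ((W \<omega> \<bullet> k) * (W \<omega> \<bullet> l)))
      (\<Sum>k\<in>Basis. \<Sum>l\<in>Basis. ((k \<bullet> l) * (b \<bullet> b) + 2 * (k \<bullet> b) * (l \<bullet> b)) * (\<integral>\<omega>. (W \<omega> \<bullet> k) * (W \<omega> \<bullet> l) \<partial>gauss_space))"
    by (intro has_bochner_integral_sum gdir_independent[where t = t] int depends_on_mult depends_on_power depends_on_gdir
        gdir_mixed_fourth_moment depends_on_inner W_past)
  also have "(\<Sum>k\<in>Basis. \<Sum>l\<in>Basis. ((k \<bullet> l) * (b \<bullet> b) + 2 * (k \<bullet> b) * (l \<bullet> b)) * (\<integral>\<omega>. (W \<omega> \<bullet> k) * (W \<omega> \<bullet> l) \<partial>gauss_space))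
      = (\<integral>\<omega>. (\<Sum>k\<in>Basis. \<Sum>l\<in>Basis. ((k \<bullet> l) * (b \<bullet> b) + 2 * (k \<bullet> b) * (l \<bullet> b)) * ((W \<omega> \<bullet> k) * (W \<omega> \<bullet> l))) \<partial>gauss_space)"
    using int by simp
  also have "(\<lambda>\<omega>. \<Sum>k\<in>Basis. \<Sum>l\<in>Basis. ((k \<bullet> l) * (b \<bullet> b) + 2 * (k \<bullet> b) * (l \<bullet> b)) * ((W \<omega> \<bullet> k) * (W \<omega> \<bullet> l)))
      = (\<lambda>\<omega>. (W \<omega> \<bullet> W \<omega>) * (b \<bullet> b) + 2 * (W \<omega> \<bullet> b)\<^sup>2)"
  proof
    fix \<omega>
    define x where "x = W \<omega>"
    have ib: "(\<Sum>l\<in>Basis. (y \<bullet> l) * (l \<bullet> z)) = y \<bullet> z" for y z :: "real^'n"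
      by (simp add: euclidean_inner[of y z] inner_commute[of z])
    have "(\<Sum>l\<in>Basis. ((k \<bullet> l) * (b \<bullet> b) + 2 * (k \<bullet> b) * (l \<bullet> b)) * ((x \<bullet> k) * (x \<bullet> l)))
        = (x \<bullet> k) * (k \<bullet> x) * (b \<bullet> b) + 2 * ((x \<bullet> k) * (k \<bullet> b)) * (x \<bullet> b)" for k
    proof -
      have "((k \<bullet> l) * (b \<bullet> b) + 2 * (k \<bullet> b) * (l \<bullet> b)) * ((x \<bullet> k) * (x \<bullet> l))
          = ((k \<bullet> l) * (l \<bullet> x)) * ((b \<bullet> b) * (x \<bullet> k)) + ((x \<bullet> l) * (l \<bullet> b)) * (2 * (k \<bullet> b) * (x \<bullet> k))" for l
        by (simp add: inner_commute[of l x] algebra_simps)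
      then have "(\<Sum>l\<in>Basis. ((k \<bullet> l) * (b \<bullet> b) + 2 * (k \<bullet> b) * (l \<bullet> b)) * ((x \<bullet> k) * (x \<bullet> l)))
          = (k \<bullet> x) * ((b \<bullet> b) * (x \<bullet> k)) + (x \<bullet> b) * (2 * (k \<bullet> b) * (x \<bullet> k))"
        by (simp only: sum.distrib sum_distrib_right[symmetric] ib)
      then show ?thesis by (simp add: algebra_simps)
    qed
    then have "(\<Sum>k\<in>Basis. \<Sum>l\<in>Basis. ((k \<bullet> l) * (b \<bullet> b) + 2 * (k \<bullet> b) * (l \<bullet> b)) * ((x \<bullet> k) * (x \<bullet> l)))
        = (x \<bullet> x) * (b \<bullet> b) + 2 * (x \<bullet> b) * (x \<bullet> b)"
      by (simp only: sum.distrib sum_distrib_right[symmetric] sum_distrib_left[symmetric] ib)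
    then show "(\<Sum>k\<in>Basis. \<Sum>l\<in>Basis. ((k \<bullet> l) * (b \<bullet> b) + 2 * (k \<bullet> b) * (l \<bullet> b)) * ((W \<omega> \<bullet> k) * (W \<omega> \<bullet> l)))
      = (W \<omega> \<bullet> W \<omega>) * (b \<bullet> b) + 2 * (W \<omega> \<bullet> b)\<^sup>2"
      by (simp add: x_def power2_eq_square)
  qed
  also have "(\<lambda>\<omega>. \<Sum>k\<in>Basis. \<Sum>l\<in>Basis. (gdir \<omega> t \<bullet> k) * (gdir \<omega> t \<bullet> l) * (gdir \<omega> t \<bullet> b)\<^sup>2 * ((W \<omega> \<bullet> k) * (W \<omega> \<bullet> l)))
      = (\<lambda>\<omega>. ((gdir \<omega> t \<bullet> W \<omega>) * (gdir \<omega> t \<bullet> b))\<^sup>2)"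
  proof
    fix \<omega> :: "nat \<times> 'n \<Rightarrow> real"
    define u where "u = gdir \<omega> t"
    have sq: "(u \<bullet> W \<omega>) * (u \<bullet> W \<omega>) = (\<Sum>k\<in>Basis. \<Sum>l\<in>Basis. ((u \<bullet> k) * (W \<omega> \<bullet> k)) * ((u \<bullet> l) * (W \<omega> \<bullet> l)))"
      unfolding euclidean_inner[of u "W \<omega>"] sum_product ..
    have "((u \<bullet> W \<omega>) * (u \<bullet> b))\<^sup>2 = (u \<bullet> W \<omega>) * (u \<bullet> W \<omega>) * (u \<bullet> b)\<^sup>2"
      by (simp add: power2_eq_square)
    also have "\<dots> = (\<Sum>k\<in>Basis. \<Sum>l\<in>Basis. ((u \<bullet> k) * (W \<omega> \<bullet> k)) * ((u \<bullet> l) * (W \<omega> \<bullet> l)) * (u \<bullet> b)\<^sup>2)"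
      unfolding sq sum_distrib_right ..
    also have "\<dots> = (\<Sum>k\<in>Basis. \<Sum>l\<in>Basis. (u \<bullet> k) * (u \<bullet> l) * (u \<bullet> b)\<^sup>2 * ((W \<omega> \<bullet> k) * (W \<omega> \<bullet> l)))"
      by (intro sum.cong refl) (simp add: algebra_simps)
    finally show "(\<Sum>k\<in>Basis. \<Sum>l\<in>Basis. (gdir \<omega> t \<bullet> k) * (gdir \<omega> t \<bullet> l) * (gdir \<omega> t \<bullet> b)\<^sup>2 * ((W \<omega> \<bullet> k) * (W \<omega> \<bullet> l)))
      = ((gdir \<omega> t \<bullet> W \<omega>) * (gdir \<omega> t \<bullet> b))\<^sup>2"
      unfolding u_def ..
  qed
  finally show ?thesis .
qed

end

subsection \<open>Frozen ZO-Adam on the quadratic model\<close>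

text \<open>In the central difference of a quadratic the terms of even order in \<open>mu\<close>
  cancel, so the estimator is an exact directional derivative and \<open>mu\<close>
  disappears.\<close>

lemma zo_grad_f_quad:
  fixes H :: "real^'n^'n"
  assumes "transpose H = H" "mu \<noteq> 0"
  shows "zo_grad (f_quad fs H xs) mu x u = (u \<bullet> (H *v (x - xs))) *\<^sub>R u"
proof -
  define z where "z = x - xs"
  have z: "x + mu *\<^sub>R u - xs = z + mu *\<^sub>R u" "x - mu *\<^sub>R u - xs = z - mu *\<^sub>R u"
    by (simp_all add: z_def)
  have "z \<bullet> (H *v u) = u \<bullet> (H *v z)"
    using inner_symmetric_matrix[OF assms(1), of z u] by (simp add: inner_commute)
  then have "f_quad fs H xs (x + mu *\<^sub>R u) - f_quad fs H xs (x - mu *\<^sub>R u) = 2 * mu * (u \<bullet> (H *v z))"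
    unfolding f_quad_def z
    by (simp add: matrix_vector_right_distrib matrix_vector_mult_diff_distrib matrix_vector_mult_scaleR
        inner_add_left inner_add_right inner_diff_left inner_diff_right algebra_simps)
  then show ?thesis using assms(2) by (simp add: zo_grad_def z_def)
qed

lemma pd_matrix_invertible:
  fixes P :: "real^'n^'n"
  assumes "\<forall>v. v \<noteq> 0 \<longrightarrow> v \<bullet> (P *v v) > 0"
  shows "matrix_inv P ** P = mat 1" "P ** matrix_inv P = mat 1"
proof -
  have "\<exists>B. B ** P = mat 1"
    unfolding matrix_left_invertible_ker using assms by (metis inner_zero_right less_irrefl)
  then have "invertible P" by (simp add: invertible_left_inverse)
  then have "\<exists>A'. P ** A' = mat 1 \<and> A' ** P = mat 1" by (simp add: invertible_def)
  then have "P ** matrix_inv P = mat 1 \<and> matrix_inv P ** P = mat 1"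
    unfolding matrix_inv_def by (rule someI_ex)
  then show "matrix_inv P ** P = mat 1" "P ** matrix_inv P = mat 1" by auto
qed

locale frozen_zo_adam =
  fixes fs :: real and H P :: "real^'n^'n" and xs :: "real^'n" and mu \<beta> \<eta> :: real and x0 :: "real^'n"
  assumes H_sym: "transpose H = H" and P_sym: "transpose P = P" and mu: "mu \<noteq> 0" and P_pd: "\<forall>v. v \<noteq> 0 \<longrightarrow> v \<bullet> (P *v v) > 0"
    and beta: "0 \<le> \<beta>" "\<beta> < 1" and eta: "0 < \<eta>"
begin

definition Z :: "nat \<Rightarrow> (nat \<times> 'n \<Rightarrow> real) \<Rightarrow> real^'n" where
  "Z t \<omega> = fst (zo_adam (f_quad fs H xs) P mu \<beta> \<eta> x0 \<omega> t) - xs"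

definition M :: "nat \<Rightarrow> (nat \<times> 'n \<Rightarrow> real) \<Rightarrow> real^'n" where
  "M t \<omega> = snd (zo_adam (f_quad fs H xs) P mu \<beta> \<eta> x0 \<omega> t)"

lemma Z_0: "Z 0 \<omega> = x0 - xs" and M_0: "M 0 \<omega> = 0"
  by (simp_all add: Z_def M_def)

lemma M_Suc: "M (Suc t) \<omega> = \<beta> *\<^sub>R M t \<omega> + (1 - \<beta>) *\<^sub>R ((gdir \<omega> t \<bullet> (H *v Z t \<omega>)) *\<^sub>R gdir \<omega> t)"
  by (simp add: M_def Z_def case_prod_unfold Let_def zo_grad_f_quad[OF H_sym mu])

lemma Z_Suc: "Z (Suc t) \<omega> = Z t \<omega> - \<eta> *\<^sub>R (matrix_inv P *v M (Suc t) \<omega>)"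
  by (simp add: M_def Z_def case_prod_unfold Let_def)

lemma M_Suc_inner:
  "M (Suc t) \<omega> \<bullet> a = \<beta> * (M t \<omega> \<bullet> a) + (1 - \<beta>) * ((gdir \<omega> t \<bullet> (H *v Z t \<omega>)) * (gdir \<omega> t \<bullet> a))"
  by (simp add: M_Suc inner_add_left)

lemma Z_Suc_inner:
  "Z (Suc t) \<omega> \<bullet> a = Z t \<omega> \<bullet> a + (- \<eta>) * (M (Suc t) \<omega> \<bullet> (transpose (matrix_inv P) *v a))"
  by (simp add: Z_Suc inner_diff_left matrix_vector_inner del: transpose_matrix_vector)

text \<open>Pairing the position with P a cancels the preconditioner in the update; for this reason
  positions are measured through \<open>P\<close> and momenta are not.\<close>

lemma Z_Suc_inner_P: "Z (Suc t) \<omega> \<bullet> (P *v a) = Z t \<omega> \<bullet> (P *v a) - \<eta> * (M (Suc t) \<omega> \<bullet> a)"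
proof -
  have "transpose (matrix_inv P) ** P = mat 1"
    using arg_cong[OF pd_matrix_invertible(2)[OF P_pd], of transpose]
    by (simp add: matrix_transpose_mul P_sym transpose_mat)
  then have "transpose (matrix_inv P) *v (P *v a) = a"
    by (simp add: matrix_vector_mul_assoc del: transpose_matrix_vector)
  then show ?thesis unfolding Z_Suc_inner by simp
qed

lemma H_eigenvector:
  assumes "(matrix_inv P ** H) *v a = l *\<^sub>R a"
  shows "H *v a = l *\<^sub>R (P *v a)"
proof -
  have "H *v a = (P ** (matrix_inv P ** H)) *v a"
    by (simp add: matrix_mul_assoc pd_matrix_invertible[OF P_pd])
  also have "\<dots> = l *\<^sub>R (P *v a)"
    unfolding matrix_vector_mul_assoc[symmetric, of P] assms by (rule matrix_vector_mult_scaleR)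
  finally show ?thesis .
qed

text \<open>The bound is strict: the iterate at time \<open>t\<close> has not seen direction
  \<open>t\<close>, which is therefore independent of it.\<close>

lemma past: "depends_on ({..<t} \<times> UNIV) (Z t)" "depends_on ({..<t} \<times> UNIV) (M t)"
proof (induction t)
  case 0
  have "Z 0 = (\<lambda>_. x0 - xs)" "M 0 = (\<lambda>_. 0)" by (auto simp: Z_0 M_0 fun_eq_iff)
  then show "depends_on ({..<0} \<times> UNIV) (Z 0)" "depends_on ({..<0} \<times> UNIV) (M 0)" by auto
next
  case (Suc t)
  have sub: "{..<t} \<times> UNIV \<subseteq> {..<Suc t} \<times> (UNIV :: 'n set)" "{t} \<times> UNIV \<subseteq> {..<Suc t} \<times> (UNIV :: 'n set)"
    by auto
  note Z = depends_on_mono[OF Suc(1) sub(1)] and M = depends_on_mono[OF Suc(2) sub(1)]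
    and u = depends_on_mono[OF depends_on_gdir_vec sub(2)]
  show M': "depends_on ({..<Suc t} \<times> UNIV) (M (Suc t))"
    by (rule depends_on_vecI, unfold M_Suc_inner)
      (intro depends_on_add depends_on_mult depends_on_const depends_on_inner2 depends_on_inner
        depends_on_matrix_vector Z M u)
  show "depends_on ({..<Suc t} \<times> UNIV) (Z (Suc t))"
    by (rule depends_on_vecI, unfold Z_Suc_inner)
      (intro depends_on_add depends_on_mult depends_on_const depends_on_inner Z M')
qed

lemma HZ_past: "depends_on ({..<t} \<times> UNIV) (\<lambda>\<omega>. H *v Z t \<omega>)"
  by (rule depends_on_matrix_vector[OF past(1)])

lemma square_int: "square_int (\<lambda>\<omega>. Z t \<omega> \<bullet> a)" "square_int (\<lambda>\<omega>. M t \<omega> \<bullet> a)"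
proof (induction t arbitrary: a)
  case 0
  show "square_int (\<lambda>\<omega>. Z 0 \<omega> \<bullet> a)" "square_int (\<lambda>\<omega>. M 0 \<omega> \<bullet> a)" for a
    by (simp_all add: Z_0 M_0)
next
  case (Suc t)
  have HZ: "square_int (\<lambda>\<omega>. (H *v Z t \<omega>) \<bullet> a)" for a
    unfolding matrix_vector_inner by (rule Suc)
  show M': "square_int (\<lambda>\<omega>. M (Suc t) \<omega> \<bullet> a)" for a
    unfolding M_Suc_inner
    by (intro square_int_add square_int_cmult Suc gdir_noise_square_int[OF HZ_past HZ])
  show "square_int (\<lambda>\<omega>. Z (Suc t) \<omega> \<bullet> a)" for a
    unfolding Z_Suc_inner by (intro square_int_add square_int_cmult Suc M')
qed

lemma HZ_square_int: "square_int (\<lambda>\<omega>. (H *v Z t \<omega>) \<bullet> a)"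
  unfolding matrix_vector_inner by (rule square_int)

lemma integrable_Z: "integrable gauss_space (Z t)"
proof -
  have "integrable gauss_space (\<lambda>\<omega>. \<Sum>b\<in>Basis. (Z t \<omega> \<bullet> b) *\<^sub>R b)"
    by (intro Bochner_Integration.integrable_sum integrable_scaleR_left impI square_int_integrable square_int)
  then show ?thesis by (simp add: euclidean_representation)
qed

lemma expectation_Z_inner: "(\<integral>\<omega>. Z t \<omega> \<partial>gauss_space) \<bullet> a = (\<integral>\<omega>. Z t \<omega> \<bullet> a \<partial>gauss_space)"
  by (rule integral_inner_left[symmetric]) (simp add: integrable_Z)

section \<open>Mean of the iterates in a P-orthonormal eigenbasis\<close>

context
  fixes lam :: "'n \<Rightarrow> real" and v :: "'n \<Rightarrow> real^'n"
  assumes lam: "\<And>i. 0 \<le> lam i"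
    and orth: "\<And>i j. v i \<bullet> (P *v v j) = (if i = j then 1 else 0)"
    and eig: "\<And>i. (matrix_inv P ** H) *v v i = lam i *\<^sub>R v i"
begin

lemma mean_mode:
  "heavy_ball_mode \<beta> \<eta> (lam i) (\<lambda>t. (\<integral>\<omega>. Z t \<omega> \<partial>gauss_space) \<bullet> (P *v v i)) (\<lambda>t. \<integral>\<omega>. M t \<omega> \<bullet> v i \<partial>gauss_space)"
proof (unfold_locales)
  show "0 \<le> \<beta>" "\<beta> < 1" "0 < \<eta>" "0 \<le> lam i" by (fact beta eta lam)+
  show "(\<integral>\<omega>. M 0 \<omega> \<bullet> v i \<partial>gauss_space) = 0" by (simp add: M_0)
  fix t
  have "(\<integral>\<omega>. (gdir \<omega> t \<bullet> (H *v Z t \<omega>)) * (gdir \<omega> t \<bullet> v i) * 1 \<partial>gauss_space)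
      = (\<integral>\<omega>. ((H *v Z t \<omega>) \<bullet> v i) * 1 \<partial>gauss_space)"
    by (intro has_bochner_integral_integral_eq gdir_noise_mean HZ_past HZ_square_int) auto
  also have "\<dots> = (\<integral>\<omega>. lam i * (Z t \<omega> \<bullet> (P *v v i)) \<partial>gauss_space)"
    unfolding matrix_vector_inner H_sym H_eigenvector[OF eig] by simp
  also have "\<dots> = lam i * ((\<integral>\<omega>. Z t \<omega> \<partial>gauss_space) \<bullet> (P *v v i))" by (simp add: expectation_Z_inner)
  finally have noise: "(\<integral>\<omega>. (gdir \<omega> t \<bullet> (H *v Z t \<omega>)) * (gdir \<omega> t \<bullet> v i) \<partial>gauss_space)
      = lam i * ((\<integral>\<omega>. Z t \<omega> \<partial>gauss_space) \<bullet> (P *v v i))" by simp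
  have "(\<integral>\<omega>. M (Suc t) \<omega> \<bullet> v i \<partial>gauss_space) = \<beta> * (\<integral>\<omega>. M t \<omega> \<bullet> v i \<partial>gauss_space)
      + (1 - \<beta>) * (\<integral>\<omega>. (gdir \<omega> t \<bullet> (H *v Z t \<omega>)) * (gdir \<omega> t \<bullet> v i) \<partial>gauss_space)"
    unfolding M_Suc_inner
    using square_int_integrable[OF square_int(2)[of t "v i"]]
      square_int_integrable[OF gdir_noise_square_int[OF HZ_past HZ_square_int, of t "v i"]] by simp
  then show "(\<integral>\<omega>. M (Suc t) \<omega> \<bullet> v i \<partial>gauss_space) = \<beta> * (\<integral>\<omega>. M t \<omega> \<bullet> v i \<partial>gauss_space)
      + (1 - \<beta>) * lam i * ((\<integral>\<omega>. Z t \<omega> \<partial>gauss_space) \<bullet> (P *v v i))"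
    by (simp add: noise)
  show "(\<integral>\<omega>. Z (Suc t) \<omega> \<partial>gauss_space) \<bullet> (P *v v i)
      = (\<integral>\<omega>. Z t \<omega> \<partial>gauss_space) \<bullet> (P *v v i) - \<eta> * (\<integral>\<omega>. M (Suc t) \<omega> \<bullet> v i \<partial>gauss_space)"
    unfolding expectation_Z_inner Z_Suc_inner_P
    using square_int_integrable[OF square_int(1)[of t "P *v v i"]]
      square_int_integrable[OF square_int(2)[of "Suc t" "v i"]] by simp
qed

lemma mean_bounded:
  assumes "\<And>i. \<eta> * (1 - \<beta>) * lam i < 2 * (1 + \<beta>)"
  shows "\<exists>B. \<forall>t. norm (\<integral>\<omega>. Z t \<omega> \<partial>gauss_space) \<le> B"
proof -
  have "\<exists>B. \<forall>t. \<bar>(\<integral>\<omega>. Z t \<omega> \<partial>gauss_space) \<bullet> (P *v v i)\<bar> \<le> B" for i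
    by (rule heavy_ball_mode.bounded[OF mean_mode assms])
  then obtain B where B: "\<And>i t. \<bar>(\<integral>\<omega>. Z t \<omega> \<partial>gauss_space) \<bullet> (P *v v i)\<bar> \<le> B i" by metis
  have "norm (\<integral>\<omega>. Z t \<omega> \<partial>gauss_space) \<le> (\<Sum>i\<in>UNIV. B i * norm (v i))" for t
  proof -
    let ?z = "\<integral>\<omega>. Z t \<omega> \<partial>gauss_space"
    have "norm ?z = norm (\<Sum>i\<in>UNIV. (v i \<bullet> (P *v ?z)) *\<^sub>R v i)"
      by (rule arg_cong[OF orthonormal_expansion[OF orth]])
    also have "\<dots> \<le> (\<Sum>i\<in>UNIV. norm ((v i \<bullet> (P *v ?z)) *\<^sub>R v i))" by (rule norm_sum)
    also have "\<dots> \<le> (\<Sum>i\<in>UNIV. B i * norm (v i))"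
    proof (rule sum_mono)
      fix i
      have "v i \<bullet> (P *v ?z) = ?z \<bullet> (P *v v i)"
        using inner_symmetric_matrix[OF P_sym, of "v i" ?z] by (simp add: inner_commute)
      then show "norm ((v i \<bullet> (P *v ?z)) *\<^sub>R v i) \<le> B i * norm (v i)"
        using B[of t i] by (simp add: mult_right_mono)
    qed
    finally show ?thesis .
  qed
  then show ?thesis by blast
qed

text \<open>Starting at distance v k from the minimiser makes the \<open>k\<close>-th coordinate
  equal to 1, so the unstable mode is excited.\<close>

lemma mean_unbounded:
  assumes "\<eta> * (1 - \<beta>) * lam k > 2 * (1 + \<beta>)" and x0: "x0 = xs + v k"
  shows "\<not> (\<forall>t. norm (\<integral>\<omega>. Z t \<omega> \<partial>gauss_space) \<le> B)"
proof
  assume B: "\<forall>t. norm (\<integral>\<omega>. Z t \<omega> \<partial>gauss_space) \<le> B"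
  have "\<bar>(\<integral>\<omega>. Z t \<omega> \<partial>gauss_space) \<bullet> (P *v v k)\<bar> \<le> B * norm (P *v v k)" for t
    using B by (intro order_trans[OF Cauchy_Schwarz_ineq2] mult_right_mono) auto
  moreover have "\<not> (\<forall>t. \<bar>(\<integral>\<omega>. Z t \<omega> \<partial>gauss_space) \<bullet> (P *v v k)\<bar> \<le> B * norm (P *v v k))"
  proof (rule heavy_ball_mode.unbounded[OF mean_mode assms(1)])
    show "(\<integral>\<omega>. Z 0 \<omega> \<partial>gauss_space) \<bullet> (P *v v k) \<noteq> 0"
      unfolding expectation_Z_inner Z_0 by (simp add: x0 orth)
  qed
  ultimately show False by blast
qed

end

section \<open>Second moments of the iterates in a Euclidean orthonormal eigenbasis\<close>

lemma norm_square_integrable: "integrable gauss_space (\<lambda>\<omega>. (norm (Z t \<omega>))\<^sup>2)"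
proof -
  have "integrable gauss_space (\<lambda>\<omega>. \<Sum>b\<in>Basis. (Z t \<omega> \<bullet> b)\<^sup>2)"
    using square_int(1)[of t] by (intro Bochner_Integration.integrable_sum) (simp add: square_int_def)
  moreover have "(norm x)\<^sup>2 = (\<Sum>b\<in>Basis. (x \<bullet> b)\<^sup>2)" for x :: "real^'n"
    by (simp add: power2_norm_eq_inner euclidean_inner[of x x] power2_eq_square[of "x \<bullet> _"])
  ultimately show ?thesis by simp
qed

lemma nn_integral_norm_square:
  "(\<integral>\<^sup>+\<omega>. ennreal ((norm (Z t \<omega>))\<^sup>2) \<partial>gauss_space) = ennreal (\<integral>\<omega>. (norm (Z t \<omega>))\<^sup>2 \<partial>gauss_space)"
  by (rule nn_integral_eq_integral[OF norm_square_integrable]) simp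

context
  fixes lam :: "'n \<Rightarrow> real" and e :: "'n \<Rightarrow> real^'n"
  assumes lam: "\<And>i. 0 \<le> lam i"
    and orth: "\<And>i j. e i \<bullet> e j = (if i = j then 1 else 0)"
    and eig: "\<And>i. (matrix_inv P ** H) *v e i = lam i *\<^sub>R e i"
begin

lemma norm_square_orthonormal: "x \<bullet> x = (\<Sum>i\<in>UNIV. (x \<bullet> e i)\<^sup>2)"
proof -
  have "e i \<bullet> (mat 1 *v e j) = (if i = j then 1 else 0)" for i j by (simp add: orth)
  from orthonormal_expansion[OF this, of x] have "x = (\<Sum>i\<in>UNIV. (e i \<bullet> x) *\<^sub>R e i)" by simp
  then have "x \<bullet> x = x \<bullet> (\<Sum>i\<in>UNIV. (e i \<bullet> x) *\<^sub>R e i)" by simp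
  then show ?thesis by (simp add: inner_sum_right power2_eq_square inner_commute)
qed

definition q2 :: "nat \<Rightarrow> 'n \<Rightarrow> real" where
  "q2 t i = (\<integral>\<omega>. (Z t \<omega> \<bullet> (P *v e i))\<^sup>2 \<partial>gauss_space)"

definition m2 :: "nat \<Rightarrow> 'n \<Rightarrow> real" where
  "m2 t i = (\<integral>\<omega>. (M t \<omega> \<bullet> e i)\<^sup>2 \<partial>gauss_space)"

definition qm :: "nat \<Rightarrow> 'n \<Rightarrow> real" where
  "qm t i = (\<integral>\<omega>. (Z t \<omega> \<bullet> (P *v e i)) * (M t \<omega> \<bullet> e i) \<partial>gauss_space)"

text \<open>Euclidean orthonormality enters in \<open>N2\<close>: by Parseval |Hz|^2 is the sum of
  the squares of lam j times the coordinates of P z, so the coupling term is again a combination of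
  the moments \<open>q2\<close>.\<close>

lemma moment_recursion: "moment_recursion \<beta> \<eta> lam q2 m2 qm"
proof (unfold_locales)
  show "0 \<le> \<beta>" "\<beta> < 1" "0 < \<eta>" by (fact beta eta)+
  show "0 \<le> lam i" for i by (rule lam)
  show "0 \<le> q2 t i" "0 \<le> m2 t i" for t i by (simp_all add: q2_def m2_def)
  show "(qm t i)\<^sup>2 \<le> q2 t i * m2 t i" for t i
    unfolding qm_def q2_def m2_def by (intro expectation_product_le square_int)
  show "m2 0 i = 0" for i by (simp add: m2_def M_0)
  fix t i
  let ?q = "\<lambda>\<omega>. Z t \<omega> \<bullet> (P *v e i)" and ?m = "\<lambda>\<omega>. M t \<omega> \<bullet> e i" and ?m' = "\<lambda>\<omega>. M (Suc t) \<omega> \<bullet> e i"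
  let ?N = "\<lambda>\<omega>. (gdir \<omega> t \<bullet> (H *v Z t \<omega>)) * (gdir \<omega> t \<bullet> e i)"
  have q: "square_int ?q" and m: "square_int ?m" and m': "square_int ?m'" by (rule square_int)+
  have N: "square_int ?N" by (rule gdir_noise_square_int[OF HZ_past HZ_square_int])
  have W: "(H *v Z t \<omega>) \<bullet> e j = lam j * (Z t \<omega> \<bullet> (P *v e j))" for \<omega> j
    unfolding matrix_vector_inner H_sym H_eigenvector[OF eig] by simp
  have Nm: "(\<integral>\<omega>. ?N \<omega> * ?m \<omega> \<partial>gauss_space) = lam i * qm t i"
    using has_bochner_integral_integral_eq[OF gdir_noise_mean[OF HZ_past HZ_square_int depends_on_inner[OF past(2)] m, of "e i"]]
    by (simp add: W qm_def mult.assoc)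
  have Nq: "(\<integral>\<omega>. ?N \<omega> * ?q \<omega> \<partial>gauss_space) = lam i * q2 t i"
    using has_bochner_integral_integral_eq[OF gdir_noise_mean[OF HZ_past HZ_square_int depends_on_inner[OF past(1)] q, of "e i"]]
    by (simp add: W q2_def mult.assoc power2_eq_square)
  have N2: "(\<integral>\<omega>. (?N \<omega>)\<^sup>2 \<partial>gauss_space) = 2 * (lam i)\<^sup>2 * q2 t i + (\<Sum>j\<in>UNIV. (lam j)\<^sup>2 * q2 t j)"
  proof -
    have "(\<integral>\<omega>. (?N \<omega>)\<^sup>2 \<partial>gauss_space)
        = (\<integral>\<omega>. ((H *v Z t \<omega>) \<bullet> (H *v Z t \<omega>)) * (e i \<bullet> e i) + 2 * ((H *v Z t \<omega>) \<bullet> e i)\<^sup>2 \<partial>gauss_space)"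
      by (rule has_bochner_integral_integral_eq[OF gdir_noise_second_moment[OF HZ_past HZ_square_int]])
    also have "\<dots> = (\<integral>\<omega>. (\<Sum>j\<in>UNIV. (lam j)\<^sup>2 * (Z t \<omega> \<bullet> (P *v e j))\<^sup>2) + 2 * ((lam i)\<^sup>2 * (Z t \<omega> \<bullet> (P *v e i))\<^sup>2) \<partial>gauss_space)"
      unfolding norm_square_orthonormal[of "H *v Z t _"] W power_mult_distrib by (simp add: orth)
    also have "\<dots> = (\<Sum>j\<in>UNIV. (lam j)\<^sup>2 * q2 t j) + 2 * ((lam i)\<^sup>2 * q2 t i)"
    proof -
      have int: "integrable gauss_space (\<lambda>\<omega>. (Z t \<omega> \<bullet> (P *v e j))\<^sup>2)" for j
        using square_int(1)[of t "P *v e j"] by (simp add: square_int_def)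
      show ?thesis using int by (simp add: q2_def)
    qed
    finally show ?thesis by simp
  qed
  note M' = M_Suc_inner[of t _ "e i"]
  have int: "integrable gauss_space (\<lambda>\<omega>. (?q \<omega>)\<^sup>2)" "integrable gauss_space (\<lambda>\<omega>. (?m \<omega>)\<^sup>2)"
    "integrable gauss_space (\<lambda>\<omega>. (?m' \<omega>)\<^sup>2)" "integrable gauss_space (\<lambda>\<omega>. (?N \<omega>)\<^sup>2)"
    "integrable gauss_space (\<lambda>\<omega>. ?N \<omega> * ?m \<omega>)" "integrable gauss_space (\<lambda>\<omega>. ?N \<omega> * ?q \<omega>)"
    "integrable gauss_space (\<lambda>\<omega>. ?q \<omega> * ?m \<omega>)" "integrable gauss_space (\<lambda>\<omega>. ?q \<omega> * ?m' \<omega>)"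
    using q m m' N by (auto intro: square_int_mult_integrable) (auto simp: square_int_def)
  \<comment> \<open>The old position against the new momentum: this moment occurs in the updates of
    both \<open>qm\<close> and \<open>q2\<close>.\<close>
  have qm': "(\<integral>\<omega>. ?q \<omega> * ?m' \<omega> \<partial>gauss_space) = \<beta> * qm t i + (1 - \<beta>) * lam i * q2 t i"
  proof -
    have "(\<integral>\<omega>. ?q \<omega> * ?m' \<omega> \<partial>gauss_space) = (\<integral>\<omega>. \<beta> * (?q \<omega> * ?m \<omega>) + (1 - \<beta>) * (?N \<omega> * ?q \<omega>) \<partial>gauss_space)"
      unfolding M' by (intro Bochner_Integration.integral_cong refl) (simp add: algebra_simps)
    also have "\<dots> = \<beta> * qm t i + (1 - \<beta>) * (\<integral>\<omega>. ?N \<omega> * ?q \<omega> \<partial>gauss_space)"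
      using int by (simp add: qm_def)
    finally show ?thesis by (simp add: Nq)
  qed
  show "m2 (Suc t) i = \<beta>\<^sup>2 * m2 t i + 2 * \<beta> * (1 - \<beta>) * lam i * qm t i
        + (1 - \<beta>)\<^sup>2 * (2 * (lam i)\<^sup>2 * q2 t i + (\<Sum>j\<in>UNIV. (lam j)\<^sup>2 * q2 t j))"
  proof -
    have "m2 (Suc t) i = (\<integral>\<omega>. \<beta>\<^sup>2 * (?m \<omega>)\<^sup>2 + 2 * \<beta> * (1 - \<beta>) * (?N \<omega> * ?m \<omega>) + (1 - \<beta>)\<^sup>2 * (?N \<omega>)\<^sup>2 \<partial>gauss_space)"
      unfolding m2_def M' by (intro Bochner_Integration.integral_cong refl) (simp add: power2_eq_square algebra_simps)
    also have "\<dots> = \<beta>\<^sup>2 * m2 t i + 2 * \<beta> * (1 - \<beta>) * (\<integral>\<omega>. ?N \<omega> * ?m \<omega> \<partial>gauss_space) + (1 - \<beta>)\<^sup>2 * (\<integral>\<omega>. (?N \<omega>)\<^sup>2 \<partial>gauss_space)"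
      using int by (simp add: m2_def)
    finally show ?thesis unfolding Nm N2 by (simp only: mult.assoc)
  qed
  show "qm (Suc t) i = \<beta> * qm t i + (1 - \<beta>) * lam i * q2 t i - \<eta> * m2 (Suc t) i"
  proof -
    have "qm (Suc t) i = (\<integral>\<omega>. ?q \<omega> * ?m' \<omega> - \<eta> * (?m' \<omega>)\<^sup>2 \<partial>gauss_space)"
      unfolding qm_def Z_Suc_inner_P
      by (intro Bochner_Integration.integral_cong refl) (simp add: power2_eq_square algebra_simps)
    then show ?thesis using int by (simp add: qm' m2_def)
  qed
  show "q2 (Suc t) i = q2 t i - 2 * \<eta> * (\<beta> * qm t i + (1 - \<beta>) * lam i * q2 t i) + \<eta>\<^sup>2 * m2 (Suc t) i"
  proof -
    have "q2 (Suc t) i = (\<integral>\<omega>. (?q \<omega>)\<^sup>2 - 2 * \<eta> * (?q \<omega> * ?m' \<omega>) + \<eta>\<^sup>2 * (?m' \<omega>)\<^sup>2 \<partial>gauss_space)"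
      unfolding q2_def Z_Suc_inner_P
      by (intro Bochner_Integration.integral_cong refl) (simp add: power2_eq_square algebra_simps)
    also have "\<dots> = q2 t i - 2 * \<eta> * (\<integral>\<omega>. ?q \<omega> * ?m' \<omega> \<partial>gauss_space) + \<eta>\<^sup>2 * m2 (Suc t) i"
      using int by (simp add: q2_def m2_def)
    finally show ?thesis by (simp add: qm')
  qed
qed

lemma mean_square_bounded:
  assumes "\<And>i. \<eta> * lam i < 1 + \<beta>" "(\<Sum>i\<in>UNIV. gain \<beta> \<eta> (lam i)) < 1"
  shows "\<exists>B. \<forall>t. (\<integral>\<^sup>+\<omega>. ennreal ((norm (Z t \<omega>))\<^sup>2) \<partial>gauss_space) \<le> ennreal B"
proof -
  have "\<exists>B. \<forall>t. q2 t i \<le> B" for i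
    by (rule moment_recursion.bounded[OF moment_recursion assms])
  then obtain B where B: "\<And>i t. q2 t i \<le> B i" by metis
  obtain K where K: "\<And>x. norm (matrix_inv P *v x) \<le> norm x * K"
    using bounded_linear.nonneg_bounded[OF matrix_vector_mul_bounded_linear[of "matrix_inv P"]] by blast
  have "(\<integral>\<omega>. (norm (Z t \<omega>))\<^sup>2 \<partial>gauss_space) \<le> K\<^sup>2 * (\<Sum>i\<in>UNIV. B i)" for t
  proof -
    have int: "integrable gauss_space (\<lambda>\<omega>. (Z t \<omega> \<bullet> (P *v e j))\<^sup>2)" for j
      using square_int(1)[of t "P *v e j"] by (simp add: square_int_def)
    have "(\<integral>\<omega>. (norm (Z t \<omega>))\<^sup>2 \<partial>gauss_space) \<le> (\<integral>\<omega>. K\<^sup>2 * (\<Sum>i\<in>UNIV. (Z t \<omega> \<bullet> (P *v e i))\<^sup>2) \<partial>gauss_space)"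
    proof (rule integral_mono)
      fix \<omega>
      have "norm (Z t \<omega>) \<le> norm (P *v Z t \<omega>) * K"
        using K[of "P *v Z t \<omega>"] by (simp add: matrix_vector_mul_assoc pd_matrix_invertible[OF P_pd])
      then have "(norm (Z t \<omega>))\<^sup>2 \<le> (norm (P *v Z t \<omega>) * K)\<^sup>2" by (rule power_mono) simp
      also have "\<dots> = K\<^sup>2 * ((P *v Z t \<omega>) \<bullet> (P *v Z t \<omega>))"
        by (simp add: power_mult_distrib power2_norm_eq_inner)
      also have "\<dots> = K\<^sup>2 * (\<Sum>i\<in>UNIV. (Z t \<omega> \<bullet> (P *v e i))\<^sup>2)"
        by (subst norm_square_orthonormal) (simp only: matrix_vector_inner P_sym)
      finally show "(norm (Z t \<omega>))\<^sup>2 \<le> K\<^sup>2 * (\<Sum>i\<in>UNIV. (Z t \<omega> \<bullet> (P *v e i))\<^sup>2)" .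
    qed (use int norm_square_integrable in auto)
    also have "\<dots> = K\<^sup>2 * (\<Sum>i\<in>UNIV. q2 t i)" using int by (simp add: q2_def)
    also have "\<dots> \<le> K\<^sup>2 * (\<Sum>i\<in>UNIV. B i)" using B by (intro mult_left_mono sum_mono) auto
    finally show ?thesis .
  qed
  then show ?thesis unfolding nn_integral_norm_square by (blast intro: ennreal_leI)
qed

text \<open>The start makes P z equal to e k, exciting the mode of largest eigenvalue. If any mode
  is at the threshold then so is this one, hence one starting point serves both instability
  regimes.\<close>

lemma mean_square_unbounded:
  assumes big: "(\<exists>i. 1 + \<beta> \<le> \<eta> * lam i) \<or> (\<Sum>i\<in>UNIV. gain \<beta> \<eta> (lam i)) > 1"
    and k: "lam k > 0" "\<And>i. lam i \<le> lam k" and x0: "x0 = xs + matrix_inv P *v e k"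
  shows "\<not> (\<forall>t. (\<integral>\<^sup>+\<omega>. ennreal ((norm (Z t \<omega>))\<^sup>2) \<partial>gauss_space) \<le> ennreal B)"
proof
  assume B: "\<forall>t. (\<integral>\<^sup>+\<omega>. ennreal ((norm (Z t \<omega>))\<^sup>2) \<partial>gauss_space) \<le> ennreal B"
  \<comment> \<open>\<open>ennreal\<close> sends a negative \<open>B\<close> to 0, whence the
    maximum.\<close>
  have B': "(\<integral>\<omega>. (norm (Z t \<omega>))\<^sup>2 \<partial>gauss_space) \<le> max 0 B" for t
    using B[rule_format, of t] unfolding nn_integral_norm_square
    by (auto simp: ennreal_le_iff2 max_def)
  define C where "C = (\<Sum>i\<in>UNIV. (norm (P *v e i))\<^sup>2) * max 0 B"
  have bounded: "q2 t i \<le> C" for t i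
  proof -
    have "q2 t i \<le> (\<integral>\<omega>. (norm (P *v e i))\<^sup>2 * (norm (Z t \<omega>))\<^sup>2 \<partial>gauss_space)"
      unfolding q2_def
    proof (rule integral_mono)
      fix \<omega>
      have "\<bar>Z t \<omega> \<bullet> (P *v e i)\<bar>\<^sup>2 \<le> (norm (Z t \<omega>) * norm (P *v e i))\<^sup>2"
        by (intro power_mono Cauchy_Schwarz_ineq2) simp
      then show "(Z t \<omega> \<bullet> (P *v e i))\<^sup>2 \<le> (norm (P *v e i))\<^sup>2 * (norm (Z t \<omega>))\<^sup>2"
        by (simp add: power_mult_distrib mult.commute)
    qed (use square_int(1)[of t "P *v e i"] norm_square_integrable in \<open>auto simp: square_int_def\<close>)
    also have "\<dots> = (norm (P *v e i))\<^sup>2 * (\<integral>\<omega>. (norm (Z t \<omega>))\<^sup>2 \<partial>gauss_space)"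
      by simp
    also have "\<dots> \<le> C"
      unfolding C_def using B'
      by (intro mult_mono member_le_sum[where f = "\<lambda>i. (norm (P *v e i))\<^sup>2"] sum_nonneg) auto
    finally show ?thesis .
  qed
  have "q2 0 k = 1"
  proof -
    have "(matrix_inv P *v e k) \<bullet> (P *v e k) = (P *v (matrix_inv P *v e k)) \<bullet> e k"
      by (simp only: matrix_vector_inner[of P] P_sym)
    also have "\<dots> = 1"
      by (simp add: matrix_vector_mul_assoc pd_matrix_invertible[OF P_pd] orth)
    finally show ?thesis unfolding q2_def Z_0 by (simp add: x0)
  qed
  then have k0: "0 < q2 0 k" by simp
  have "\<not> (\<forall>t i. q2 t i \<le> C)"
  proof (cases "\<exists>i. 1 + \<beta> \<le> \<eta> * lam i")
    case True
    then obtain i where "1 + \<beta> \<le> \<eta> * lam i" by blast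
    also have "\<dots> \<le> \<eta> * lam k" using k eta by (intro mult_left_mono) auto
    finally show ?thesis
      by (rule moment_recursion.unbounded_large_eigenvalue[OF moment_recursion _ k0])
  next
    case False
    then have "\<eta> * lam i < 1 + \<beta>" for i by (meson not_le)
    then show ?thesis using big False k0
      by (intro moment_recursion.unbounded_large_sum[OF moment_recursion _ _ k(1)]) auto
  qed
  then show False using bounded by blast
qed

end

end

subsection \<open>Critical step sizes\<close>

lemma gain_mono:
  assumes "0 \<le> \<beta>" "0 \<le> l" "0 \<le> \<eta>" "\<eta> \<le> \<eta>'" "\<eta>' * l < 1 + \<beta>"
  shows "gain \<beta> \<eta> l \<le> gain \<beta> \<eta>' l"
proof -
  have le: "\<eta> * l \<le> \<eta>' * l" using assms by (intro mult_right_mono) auto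
  then have "\<eta> * l / (1 + \<beta>) \<le> \<eta>' * l / (1 + \<beta>)" using assms by (intro divide_right_mono) auto
  then have den: "2 * (1 - \<eta>' * l / (1 + \<beta>)) \<le> 2 * (1 - \<eta> * l / (1 + \<beta>))"
    by (intro mult_left_mono diff_left_mono) auto
  have "\<eta>' * l / (1 + \<beta>) < 1" using assms by simp
  then have pos: "0 < 2 * (1 - \<eta>' * l / (1 + \<beta>))"
    by (intro mult_pos_pos) (simp_all only: diff_gt_0_iff_gt zero_less_numeral)
  show ?thesis
    unfolding gain_def by (rule frac_le[OF _ le pos den]) (use assms in simp)
qed

lemma gain_strict_mono:
  assumes "0 \<le> \<beta>" "0 < l" "0 \<le> \<eta>" "\<eta> < \<eta>'" "\<eta>' * l < 1 + \<beta>"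
  shows "gain \<beta> \<eta> l < gain \<beta> \<eta>' l"
proof -
  have le: "\<eta> * l < \<eta>' * l" using assms by simp
  then have "\<eta> * l / (1 + \<beta>) \<le> \<eta>' * l / (1 + \<beta>)" using assms by (intro divide_right_mono) auto
  then have den: "2 * (1 - \<eta>' * l / (1 + \<beta>)) \<le> 2 * (1 - \<eta> * l / (1 + \<beta>))"
    by (intro mult_left_mono diff_left_mono) auto
  have "\<eta>' * l / (1 + \<beta>) < 1" using assms by simp
  then have pos: "0 < 2 * (1 - \<eta>' * l / (1 + \<beta>))"
    by (intro mult_pos_pos) (simp_all only: diff_gt_0_iff_gt zero_less_numeral)
  show ?thesis
    unfolding gain_def by (rule frac_less[OF _ le pos den]) (use assms in simp)
qed

context
  fixes \<beta> :: real and lam :: "'n::finite \<Rightarrow> real" and k :: 'n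
  assumes beta: "0 \<le> \<beta>" and lam: "\<And>i. 0 \<le> lam i" and k: "0 < lam k" "\<And>i. lam i \<le> lam k"
begin

lemma step_size_below:
  assumes "0 \<le> \<eta>" "\<eta> * lam k < 1 + \<beta>"
  shows "\<eta> * lam i < 1 + \<beta>"
  using mult_left_mono[OF k(2)[of i] assms(1)] assms(2) by linarith

lemma gain_sum_strict_mono:
  assumes "0 \<le> \<eta>" "\<eta> < \<eta>'" "\<eta>' * lam k < 1 + \<beta>"
  shows "(\<Sum>i\<in>UNIV. gain \<beta> \<eta> (lam i)) < (\<Sum>i\<in>UNIV. gain \<beta> \<eta>' (lam i))"
proof (rule sum_strict_mono_ex1)
  show "\<forall>i\<in>UNIV. gain \<beta> \<eta> (lam i) \<le> gain \<beta> \<eta>' (lam i)"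
    using assms beta lam step_size_below[of \<eta>'] by (intro ballI gain_mono) auto
  show "\<exists>i\<in>UNIV. gain \<beta> \<eta> (lam i) < gain \<beta> \<eta>' (lam i)"
    using assms beta k by (intro bexI[of _ k] gain_strict_mono) auto
qed simp

lemma ex1_critical_step_size:
  "\<exists>!\<eta>. 0 < \<eta> \<and> \<eta> * lam k < 1 + \<beta> \<and> (\<Sum>i\<in>UNIV. gain \<beta> \<eta> (lam i)) = 1"
proof -
  define F where "F \<eta> = (\<Sum>i\<in>UNIV. gain \<beta> \<eta> (lam i))" for \<eta>
  \<comment> \<open>The step size at which the top mode alone has gain 1. The sum is then at least
    1, and the interval from 0 to \<open>\<eta>1\<close> stays clear of the poles of all gains, so
    the intermediate value theorem applies.\<close>
  define \<eta>1 where "\<eta>1 = 2 * (1 + \<beta>) / ((3 + \<beta>) * lam k)"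
  have \<eta>1: "0 < \<eta>1" using beta k by (simp add: \<eta>1_def)
  have \<eta>1k: "\<eta>1 * lam k = 2 * (1 + \<beta>) / (3 + \<beta>)" using k by (simp add: \<eta>1_def)
  have "2 * (1 + \<beta>) < (3 + \<beta>) * (1 + \<beta>)" using beta by (intro mult_strict_right_mono) auto
  then have small: "\<eta>1 * lam k < 1 + \<beta>"
    unfolding \<eta>1k using beta by (simp add: pos_divide_less_eq mult.commute)
  have "1 - \<eta>1 * lam k / (1 + \<beta>) = (1 + \<beta>) / (3 + \<beta>)"
  proof -
    have "2 * (1 + \<beta>) / (3 + \<beta>) / (1 + \<beta>) = 2 / (3 + \<beta>)"
      unfolding divide_divide_eq_left by (rule nonzero_mult_divide_mult_cancel_right) (use beta in simp)
    then show ?thesis unfolding \<eta>1k using beta by (simp add: field_simps)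
  qed
  then have "gain \<beta> \<eta>1 (lam k) = 1" unfolding gain_def using \<eta>1k beta by simp
  moreover have "gain \<beta> \<eta>1 (lam k) \<le> F \<eta>1"
    unfolding F_def
  proof (rule member_le_sum[of k UNIV "\<lambda>i. gain \<beta> \<eta>1 (lam i)"])
    show "0 \<le> gain \<beta> \<eta>1 (lam i)" for i
      using gain_mono[of \<beta> "lam i" 0 \<eta>1] \<eta>1 beta lam[of i] step_size_below[OF _ small, of i]
      by (simp add: gain_def)
  qed auto
  ultimately have F1: "1 \<le> F \<eta>1" by simp
  have F0: "F 0 = 0" by (simp add: F_def gain_def)
  have nz: "2 * (1 - \<eta> * lam i / (1 + \<beta>)) \<noteq> 0" if "0 \<le> \<eta>" "\<eta> \<le> \<eta>1" for \<eta> i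
  proof -
    have "\<eta> * lam k \<le> \<eta>1 * lam k" using that k by (intro mult_right_mono) auto
    then have "\<eta> * lam i < 1 + \<beta>" using step_size_below[of \<eta> i] that small by linarith
    then show ?thesis using beta by (simp add: field_simps)
  qed
  have "continuous_on {0..\<eta>1} F"
    unfolding F_def gain_def by (intro continuous_intros ballI nz) (use beta in auto)
  then obtain \<eta> where \<eta>: "0 \<le> \<eta>" "\<eta> \<le> \<eta>1" "F \<eta> = 1"
    using IVT'[of F 0 1 \<eta>1] F0 F1 \<eta>1 by auto
  have "\<eta> \<noteq> 0" using \<eta> F0 by auto
  moreover have "\<eta> * lam k < 1 + \<beta>"
    using mult_right_mono[OF \<eta>(2), of "lam k"] k small by linarith
  ultimately have "0 < \<eta> \<and> \<eta> * lam k < 1 + \<beta> \<and> F \<eta> = 1" using \<eta> by simp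
  moreover have "x = y" if "0 < x \<and> x * lam k < 1 + \<beta> \<and> F x = 1" "0 < y \<and> y * lam k < 1 + \<beta> \<and> F y = 1" for x y
    using gain_sum_strict_mono[of x y] gain_sum_strict_mono[of y x] that
    unfolding F_def by (cases x y rule: linorder_cases) auto
  ultimately show ?thesis unfolding F_def by blast
qed

text \<open>All the factors 1 - \<eta> lam i / (1 + \<beta>) lie between the one of the top
  eigenvalue and 1; replacing them by either extreme turns the critical equation into a linear
  inequality in \<eta>.\<close>

lemma critical_step_size_bounds:
  assumes "0 < \<eta>" "\<eta> * lam k < 1 + \<beta>" "(\<Sum>i\<in>UNIV. gain \<beta> \<eta> (lam i)) = 1"
  shows "2 / ((\<Sum>i\<in>UNIV. lam i) + 2 * lam k / (1 + \<beta>)) \<le> \<eta>"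
    and "\<eta> \<le> 2 / (\<Sum>i\<in>UNIV. lam i)"
proof -
  define S where "S = (\<Sum>i\<in>UNIV. lam i)"
  have "lam k \<le> S" unfolding S_def by (rule member_le_sum) (auto simp: lam)
  then have S: "0 < S" using k by simp
  define D where "D = 1 - \<eta> * lam k / (1 + \<beta>)"
  have D: "0 < D" using assms beta by (simp add: D_def)
  have den: "D \<le> 1 - \<eta> * lam i / (1 + \<beta>)" "1 - \<eta> * lam i / (1 + \<beta>) \<le> 1" for i
    using assms beta lam[of i] k(2)[of i]
    by (auto simp: D_def intro!: divide_right_mono mult_left_mono)
  have "(\<Sum>i\<in>UNIV. \<eta> * lam i / 2) \<le> (\<Sum>i\<in>UNIV. gain \<beta> \<eta> (lam i))"
  proof (rule sum_mono)
    fix i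
    show "\<eta> * lam i / 2 \<le> gain \<beta> \<eta> (lam i)"
      unfolding gain_def using den[of i] D assms lam[of i] by (intro frac_le) auto
  qed
  then have "\<eta> * S / 2 \<le> 1" by (simp add: assms S_def sum_distrib_left sum_divide_distrib)
  then show "\<eta> \<le> 2 / (\<Sum>i\<in>UNIV. lam i)" using S by (simp add: S_def[symmetric] field_simps)
  have "(\<Sum>i\<in>UNIV. gain \<beta> \<eta> (lam i)) \<le> (\<Sum>i\<in>UNIV. \<eta> * lam i / (2 * D))"
  proof (rule sum_mono)
    fix i
    show "gain \<beta> \<eta> (lam i) \<le> \<eta> * lam i / (2 * D)"
      unfolding gain_def using den[of i] D assms lam[of i] by (intro frac_le) auto
  qed
  also have "\<dots> = \<eta> * S / (2 * D)" by (simp add: S_def sum_distrib_left sum_divide_distrib)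
  finally have "2 * D \<le> \<eta> * S" using assms(3) D by (simp add: field_simps)
  then have "2 \<le> \<eta> * (S + 2 * lam k / (1 + \<beta>))" by (simp add: D_def algebra_simps)
  moreover have "0 < S + 2 * lam k / (1 + \<beta>)" using S k beta by (intro add_pos_pos) auto
  ultimately show "2 / ((\<Sum>i\<in>UNIV. lam i) + 2 * lam k / (1 + \<beta>)) \<le> \<eta>"
    by (simp add: S_def[symmetric] pos_divide_le_eq)
qed

end

text \<open>Membership of \<open>c\<close> itself is left open, so stability at the critical step
  size never has to be decided.\<close>

lemma Sup_ereal_image_eq:
  fixes S :: "real set"
  assumes "0 < c" "\<And>x. 0 < x \<Longrightarrow> x < c \<Longrightarrow> x \<in> S" "\<And>x. x \<in> S \<Longrightarrow> x \<le> c"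
  shows "Sup (ereal ` S) = ereal c"
proof (rule Sup_eqI)
  show "y \<le> ereal c" if "y \<in> ereal ` S" for y using that assms(3) by auto
  fix y assume y: "\<And>z. z \<in> ereal ` S \<Longrightarrow> z \<le> y"
  show "ereal c \<le> y"
  proof (rule ccontr)
    assume "\<not> ereal c \<le> y"
    then have "max 0 y < ereal c" using assms(1) by (auto simp: max_def)
    then obtain r where r: "max 0 y < ereal r" "ereal r < ereal c" using ereal_dense2 by blast
    have "0 < ereal r" using r(1) by (rule le_less_trans[OF max.cobounded1])
    then have "0 < r" "r < c" using r(2) by auto
    then have "ereal r \<le> y" using assms(2) y by blast
    then show False using r(1) by auto
  qed
qed

theorem theorem4p10:
  fixes f :: "real^'n \<Rightarrow> real" and xstar :: "real^'n"
    and H P :: "real^'n^'n" and lam :: "'n \<Rightarrow> real"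
    and beta1 mu :: real
  assumes locmin: "\<exists>e>0. \<forall>y. dist y xstar < e \<longrightarrow> f xstar \<le> f y"
    and twice_diff: "\<exists>e>0. \<exists>g :: real^'n \<Rightarrow> real^'n. \<exists>Hf :: real^'n \<Rightarrow> real^'n^'n.
           (\<forall>y\<in>ball xstar e. (f has_derivative (\<lambda>h. g y \<bullet> h)) (at y)
                              \<and> (g has_derivative (\<lambda>h. Hf y *v h)) (at y))
           \<and> Hf xstar = H"
    and H_psd: "\<forall>v. v \<bullet> (H *v v) \<ge> 0"
    and H_nz: "H \<noteq> 0"
    and P_sym: "transpose P = P"
    and P_pd: "\<forall>v. v \<noteq> 0 \<longrightarrow> v \<bullet> (P *v v) > 0"
    and lam_eig: "charpoly (matrix_inv P ** H) = (\<Prod>i\<in>UNIV. [:- lam i, 1:])"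
    and beta1: "0 \<le> beta1" "beta1 < 1"
    and mu: "mu > 0"
  shows "crit_mean (f_quad (f xstar) H xstar) P mu beta1 xstar
           = ereal (2 * (1 + beta1) / ((1 - beta1) * Max (range lam)))
         \<and> (P ** H = H ** P \<longrightarrow>
             (let cond = (\<lambda>eta. eta > 0 \<and> eta * Max (range lam) < 1 + beta1 \<and>
                    (\<Sum>i\<in>UNIV. eta * lam i / (2 * (1 - eta * lam i / (1 + beta1)))) = 1)
              in (\<exists>!eta. cond eta)
                 \<and> (\<exists>eta. cond eta
                      \<and> crit_ms (f_quad (f xstar) H xstar) P mu beta1 xstar = ereal eta
                      \<and> 2 / (trace (matrix_inv P ** H) + 2 * Max (range lam) / (1 + beta1)) \<le> eta
                      \<and> eta \<le> 2 / trace (matrix_inv P ** H))))"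
proof -
  define A where "A = matrix_inv P ** H"
  note PI = pd_matrix_invertible[OF P_pd]
  \<comment> \<open>Symmetry is not among the hypotheses on \<open>H\<close>; it comes from
    \<open>H\<close> being the derivative of a gradient.\<close>
  have H_sym: "transpose H = H"
  proof -
    obtain r g Hf where r: "0 < r"
      and d: "\<And>y. y \<in> ball xstar r \<Longrightarrow> (f has_derivative (\<lambda>h. g y \<bullet> h)) (at y)"
        "\<And>y. y \<in> ball xstar r \<Longrightarrow> (g has_derivative (\<lambda>h. Hf y *v h)) (at y)"
      and Hf: "Hf xstar = H"
      using twice_diff by blast
    have "(g has_derivative (\<lambda>h. H *v h)) (at xstar)" using d(2)[of xstar] r Hf by simp
    from symmetric_second_derivative[OF r d(1) this]
    have sym: "u \<bullet> (H *v v) = v \<bullet> (H *v u)" for u v by blast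
    have "H $ i $ j = axis i 1 \<bullet> (H *v axis j 1)" for i j
      by (simp add: inner_axis' matrix_vector_mult_basis column_def)
    then show ?thesis using sym by (simp add: transpose_def vec_eq_iff)
  qed
  have PA: "P ** A = H" by (simp add: A_def matrix_mul_assoc PI)
  obtain v where orth: "\<And>i j. v i \<bullet> (P *v v j) = (if i = j then 1 else 0)"
    and eig: "\<And>i. A *v v i = lam i *\<^sub>R v i"
    using ex_eigenbasis[OF P_sym P_pd, of A lam] H_sym lam_eig unfolding PA A_def[symmetric] by blast
  have Hv: "H *v v i = lam i *\<^sub>R (P *v v i)" for i
    unfolding PA[symmetric] matrix_vector_mul_assoc[symmetric] eig by (rule matrix_vector_mult_scaleR)
  have lam_nonneg: "0 \<le> lam i" for i
    using H_psd[rule_format, of "v i"] by (simp add: Hv orth)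
  have "Max (range lam) \<in> range lam" by (rule Max_in) auto
  then obtain k where k1: "Max (range lam) = lam k" by blast
  have "lam i \<le> lam k" for i unfolding k1[symmetric] by (rule Max_ge) auto
  note k = k1 this
  \<comment> \<open>If the top eigenvalue were 0, all would be, and \<open>H\<close> would vanish on
    a basis.\<close>
  have "lam k \<noteq> 0"
  proof
    assume "lam k = 0"
    then have "lam i = 0" for i using k(2)[of i] lam_nonneg[of i] by simp
    then have "H *v v i = 0" for i by (simp add: Hv)
    have "H *v x = 0" for x
    proof -
      have "H *v x = H *v (\<Sum>i\<in>UNIV. (v i \<bullet> (P *v x)) *\<^sub>R v i)"
        by (rule arg_cong[OF orthonormal_expansion[OF orth]])
      also have "\<dots> = 0"
        by (simp add: linear_sum[OF matrix_vector_mul_linear] matrix_vector_mult_scaleR \<open>\<And>i. H *v v i = 0\<close>)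
      finally show ?thesis .
    qed
    then have "H = 0" by (simp add: matrix_eq)
    then show False using H_nz by simp
  qed
  then have lk: "0 < lam k" using lam_nonneg[of k] by simp
  have loc: "frozen_zo_adam H P mu beta1 eta" if "0 < eta" for eta
    using H_sym P_sym P_pd beta1 mu that by unfold_locales auto
  let ?f = "f_quad (f xstar) H xstar"
  have mean: "crit_mean ?f P mu beta1 xstar = ereal (2 * (1 + beta1) / ((1 - beta1) * Max (range lam)))"
    unfolding crit_mean_def k(1)
  proof (rule Sup_ereal_image_eq)
    show "0 < 2 * (1 + beta1) / ((1 - beta1) * lam k)" using beta1 lk by simp
  next
    fix eta :: real assume eta: "0 < eta" "eta < 2 * (1 + beta1) / ((1 - beta1) * lam k)"
    have "eta * (1 - beta1) * lam i < 2 * (1 + beta1)" for i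
    proof -
      have "eta * (1 - beta1) * lam i \<le> eta * (1 - beta1) * lam k"
        using eta beta1 k(2)[of i] by (intro mult_left_mono) auto
      also have "\<dots> < 2 * (1 + beta1)" using eta(2) beta1 lk by (simp add: pos_less_divide_eq mult.assoc)
      finally show ?thesis .
    qed
    from frozen_zo_adam.mean_bounded[OF loc[OF eta(1)] lam_nonneg orth eig[unfolded A_def] this]
    show "eta \<in> {eta. 0 < eta \<and> (\<forall>x0. \<exists>B. \<forall>t.
        norm (\<integral>\<omega>. (fst (zo_adam ?f P mu beta1 eta x0 \<omega> t) - xstar) \<partial>gauss_space) \<le> B)}"
      using eta unfolding frozen_zo_adam.Z_def[OF loc[OF eta(1)]] by blast
  next
    fix eta assume "eta \<in> {eta. 0 < eta \<and> (\<forall>x0. \<exists>B. \<forall>t.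
        norm (\<integral>\<omega>. (fst (zo_adam ?f P mu beta1 eta x0 \<omega> t) - xstar) \<partial>gauss_space) \<le> B)}"
    then have eta: "0 < eta" and bdd: "\<exists>B. \<forall>t.
        norm (\<integral>\<omega>. (fst (zo_adam ?f P mu beta1 eta (xstar + v k) \<omega> t) - xstar) \<partial>gauss_space) \<le> B" by auto
    have "\<not> eta * (1 - beta1) * lam k > 2 * (1 + beta1)"
      using frozen_zo_adam.mean_unbounded[OF loc[OF eta] lam_nonneg orth eig[unfolded A_def], of k "xstar + v k" xstar "f xstar"] bdd
      unfolding frozen_zo_adam.Z_def[OF loc[OF eta]] by blast
    then show "eta \<le> 2 * (1 + beta1) / ((1 - beta1) * lam k)"
      using beta1 lk by (simp add: pos_le_divide_eq mult.assoc)
  qed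
  define cond where "cond = (\<lambda>eta. eta > 0 \<and> eta * lam k < 1 + beta1 \<and>
                    (\<Sum>i\<in>UNIV. eta * lam i / (2 * (1 - eta * lam i / (1 + beta1)))) = 1)"
  have cond_gain: "cond = (\<lambda>eta. 0 < eta \<and> eta * lam k < 1 + beta1 \<and> (\<Sum>i\<in>UNIV. gain beta1 eta (lam i)) = 1)"
    by (simp add: cond_def gain_def)
  have ex1: "\<exists>!eta. cond eta"
    unfolding cond_gain by (rule ex1_critical_step_size[where lam = lam and k = k, OF beta1(1) lam_nonneg lk k(2)])
  then obtain eta where "cond eta" by blast
  then have eta: "0 < eta" "eta * lam k < 1 + beta1" "(\<Sum>i\<in>UNIV. gain beta1 eta (lam i)) = 1"
    by (auto simp: cond_gain)
  have tr: "trace (matrix_inv P ** H) = (\<Sum>i\<in>UNIV. lam i)"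
    using trace_eigenbasis[OF orth eig] by (simp add: A_def)
  note bounds = critical_step_size_bounds[where lam = lam and k = k, OF beta1(1) lam_nonneg lk k(2) eta]
  have "crit_ms ?f P mu beta1 xstar = ereal eta" if comm: "P ** H = H ** P"
  proof -
    \<comment> \<open>Conjugating by the inverse of \<open>P\<close> turns commutation with
      \<open>P\<close> into commutation with its inverse, which makes \<open>A\<close> a product of
      commuting symmetric matrices.\<close>
    have "A = matrix_inv P ** (H ** P) ** matrix_inv P"
      by (simp add: A_def matrix_mul_assoc[symmetric] PI)
    also have "\<dots> = H ** matrix_inv P"
      unfolding comm[symmetric] by (simp add: matrix_mul_assoc PI)
    finally have A: "A = H ** matrix_inv P" .
    have "transpose (matrix_inv P) ** P = mat 1"
      using arg_cong[OF PI(2), of transpose] by (simp add: matrix_transpose_mul P_sym transpose_mat)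
    then have "transpose (matrix_inv P) = matrix_inv P"
      by (metis PI(2) matrix_mul_assoc matrix_mul_lid matrix_mul_rid)
    then have A_sym: "transpose (mat 1 ** A) = mat 1 ** A"
      by (simp add: A matrix_transpose_mul H_sym) (simp add: A[symmetric] A_def)
    \<comment> \<open>A second eigenbasis of the same matrix for the same \<open>lam\<close>, now
      with the identity in place of \<open>P\<close> as inner product.\<close>
    obtain e where orth1: "\<And>i j. e i \<bullet> (mat 1 *v e j) = (if i = j then 1 else 0)"
      and eig: "\<And>i. A *v e i = lam i *\<^sub>R e i"
      by (rule ex_eigenbasis[OF _ _ A_sym, of lam]) (use lam_eig in \<open>auto simp: transpose_mat A_def\<close>)
    have orth: "e i \<bullet> e j = (if i = j then 1 else 0)" for i j using orth1 by simp
    show ?thesis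
      unfolding crit_ms_def
    proof (rule Sup_ereal_image_eq[OF eta(1)])
      fix x :: real assume x: "0 < x" "x < eta"
      have small: "x * lam i < 1 + beta1" for i
        using step_size_below[where lam = lam and k = k, OF beta1(1) lam_nonneg lk k(2), of x i] x eta(2) lk
          mult_strict_right_mono[OF x(2) lk] by simp
      have "(\<Sum>i\<in>UNIV. gain beta1 x (lam i)) < 1"
        using gain_sum_strict_mono[where lam = lam and k = k, OF beta1(1) lam_nonneg lk k(2), of x eta] x eta by simp
      from frozen_zo_adam.mean_square_bounded[OF loc[OF x(1)] lam_nonneg orth eig[unfolded A_def] small this]
      show "x \<in> {eta. 0 < eta \<and> (\<forall>x0. \<exists>B. \<forall>t. (\<integral>\<^sup>+\<omega>. ennreal
          ((norm (fst (zo_adam ?f P mu beta1 eta x0 \<omega> t) - xstar))\<^sup>2) \<partial>gauss_space) \<le> ennreal B)}"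
        using x unfolding frozen_zo_adam.Z_def[OF loc[OF x(1)]] by blast
    next
      fix x assume "x \<in> {eta. 0 < eta \<and> (\<forall>x0. \<exists>B. \<forall>t. (\<integral>\<^sup>+\<omega>. ennreal
          ((norm (fst (zo_adam ?f P mu beta1 eta x0 \<omega> t) - xstar))\<^sup>2) \<partial>gauss_space) \<le> ennreal B)}"
      then have x: "0 < x" and bdd: "\<exists>B. \<forall>t. (\<integral>\<^sup>+\<omega>. ennreal
          ((norm (fst (zo_adam ?f P mu beta1 x (xstar + matrix_inv P *v e k) \<omega> t) - xstar))\<^sup>2) \<partial>gauss_space) \<le> ennreal B"
        by auto
      have "\<not> ((\<exists>i. 1 + beta1 \<le> x * lam i) \<or> (\<Sum>i\<in>UNIV. gain beta1 x (lam i)) > 1)"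
        using frozen_zo_adam.mean_square_unbounded[OF loc[OF x] lam_nonneg orth eig[unfolded A_def] _ lk k(2) refl,
            where xs = xstar and fs = "f xstar"] bdd
        unfolding frozen_zo_adam.Z_def[OF loc[OF x]] by blast
      then have "x * lam k < 1 + beta1" "(\<Sum>i\<in>UNIV. gain beta1 x (lam i)) \<le> 1" by (auto simp: not_le)
      then show "x \<le> eta"
        using gain_sum_strict_mono[where lam = lam and k = k, OF beta1(1) lam_nonneg lk k(2), of eta x] eta by force
    qed
  qed
  then show ?thesis
    using mean ex1 \<open>cond eta\<close> bounds unfolding Let_def cond_def tr k(1) by blast
qed

end
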